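(* Let $G_1,G_2,G_3,\ldots$ be a sequence of finite, connected, BFS-labeled, edge-transitive graphs of bounded maximum degree that converges pointwise, with limit graph $\overline{G}$. If $\overline{G}$ has more than two ends, then $\lim_{j\to\infty}\operatorname{Had}(G_j)=\infty$.
   Context: A BFS-labeled graph is a connected graph with vertex set $\{1,\dots,n\}$ (or a subset of $\mathbb{N}$ in the limit) such that $i<j$ implies $\operatorname{dist}(1,i)\le\operatorname{dist}(1,j)$. A sequence $(X_i)$ of subsets of a set $U$ converges pointwise if for each $x\in U$, membership $x\in X_n$ is eventually constant; its limit is the set of $x$ lying in all but finitely many $X_n$. The sequence of graphs converges with limit $\overline{G}$ if $V(\overline G)$ and $E(\overline G)$ are the pointwise limits of $(V(G_i))$ and $(E(G_i))$. A ray is a one-way infinite path; two rays are equivalent if for every finite vertex set $S$ some component of $\overline{G}-S$ contains all but finitely many vertices of both; ends are the equivalence classes. $\operatorname{Had}(G)$ is the largest $h$ such that $K_h$ is a minor of $G$. Edge-transitive means the automorphism group is transitive on edges. *)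

theory Defs
  imports Complex_Main
begin

text \<open>
  Graphs are simple and undirected: an edge is a two-element set of vertices.
  The vertex set may be infinite.
\<close>

record 'a graph =
  verts :: "'a set"
  edges :: "'a set set"

definition simple_graph :: "'a graph \<Rightarrow> bool" where
  "simple_graph G \<longleftrightarrow> (\<forall>e\<in>edges G. e \<subseteq> verts G \<and> card e = 2)"

definition adj :: "'a graph \<Rightarrow> ('a \<times> 'a) set" where
  "adj G = {(u, v). {u, v} \<in> edges G}"

definition connected_graph :: "'a graph \<Rightarrow> bool" where
  "connected_graph G \<longleftrightarrow>
     verts G \<noteq> {} \<and> (\<forall>u\<in>verts G. \<forall>v\<in>verts G. (u, v) \<in> (adj G)\<^sup>*)"

text \<open>
  Since \<open>(adj G) ^^ k\<close> relates the endpoints of walks of length \<open>k\<close>, this is the usual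
  distance for vertices in a common component; it is only used in connected graphs.
\<close>

definition graph_dist :: "'a graph \<Rightarrow> 'a \<Rightarrow> 'a \<Rightarrow> nat" where
  "graph_dist G u v = (LEAST k. (u, v) \<in> (adj G) ^^ k)"

definition degree :: "'a graph \<Rightarrow> 'a \<Rightarrow> nat" where
  "degree G v = card {e \<in> edges G. v \<in> e}"

definition max_degree :: "'a graph \<Rightarrow> nat" where
  "max_degree G = Max (degree G ` verts G)"

definition BFS_labeled :: "nat graph \<Rightarrow> bool" where
  "BFS_labeled G \<longleftrightarrow>
     connected_graph G \<and> (\<exists>n. verts G = {1..n}) \<and>
     (\<forall>i\<in>verts G. \<forall>j\<in>verts G. i < j \<longrightarrow> graph_dist G 1 i \<le> graph_dist G 1 j)"

definition automorphism :: "'a graph \<Rightarrow> ('a \<Rightarrow> 'a) \<Rightarrow> bool" where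
  "automorphism G f \<longleftrightarrow>
     bij_betw f (verts G) (verts G) \<and>
     (\<forall>u\<in>verts G. \<forall>v\<in>verts G. {f u, f v} \<in> edges G \<longleftrightarrow> {u, v} \<in> edges G)"

definition edge_transitive :: "'a graph \<Rightarrow> bool" where
  "edge_transitive G \<longleftrightarrow>
     (\<forall>e\<in>edges G. \<forall>e'\<in>edges G. \<exists>f. automorphism G f \<and> f ` e = e')"

definition pointwise_convergent :: "(nat \<Rightarrow> 'a set) \<Rightarrow> bool" where
  "pointwise_convergent X \<longleftrightarrow>
     (\<forall>x. eventually (\<lambda>n. x \<in> X n) sequentially \<or> eventually (\<lambda>n. x \<notin> X n) sequentially)"

definition pointwise_limit :: "(nat \<Rightarrow> 'a set) \<Rightarrow> 'a set" where
  "pointwise_limit X = {x. eventually (\<lambda>n. x \<in> X n) sequentially}"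

definition graphs_converge :: "(nat \<Rightarrow> 'a graph) \<Rightarrow> 'a graph \<Rightarrow> bool" where
  "graphs_converge G L \<longleftrightarrow>
     pointwise_convergent (\<lambda>i. verts (G i)) \<and> pointwise_convergent (\<lambda>i. edges (G i)) \<and>
     verts L = pointwise_limit (\<lambda>i. verts (G i)) \<and>
     edges L = pointwise_limit (\<lambda>i. edges (G i))"

definition induced_subgraph :: "'a graph \<Rightarrow> 'a set \<Rightarrow> 'a graph" where
  "induced_subgraph G W = \<lparr>verts = verts G \<inter> W, edges = {e \<in> edges G. e \<subseteq> W}\<rparr>"

definition delete_verts :: "'a graph \<Rightarrow> 'a set \<Rightarrow> 'a graph" where
  "delete_verts G S = induced_subgraph G (verts G - S)"

text \<open>Components are identified with their vertex sets.\<close>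

definition components :: "'a graph \<Rightarrow> 'a set set" where
  "components G = verts G // {(u, v). u \<in> verts G \<and> v \<in> verts G \<and> (u, v) \<in> (adj G)\<^sup>*}"

text \<open>
  A ray is represented by the sequence of its vertices, starting at its unique vertex
  of degree 1, so that distinct sequences are distinct rays.
\<close>

definition rays :: "'a graph \<Rightarrow> (nat \<Rightarrow> 'a) set" where
  "rays G = {r. inj r \<and> range r \<subseteq> verts G \<and> (\<forall>i. {r i, r (Suc i)} \<in> edges G)}"

definition ray_equiv :: "'a graph \<Rightarrow> ((nat \<Rightarrow> 'a) \<times> (nat \<Rightarrow> 'a)) set" where
  "ray_equiv G = {(r, s). r \<in> rays G \<and> s \<in> rays G \<and>
     (\<forall>S. finite S \<and> S \<subseteq> verts G \<longrightarrow>
        (\<exists>C\<in>components (delete_verts G S). finite (range r - C) \<and> finite (range s - C)))}"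

definition ends :: "'a graph \<Rightarrow> (nat \<Rightarrow> 'a) set set" where
  "ends G = rays G // ray_equiv G"

text \<open>
  \<open>B v\<close> is the branch set that is contracted to the vertex \<open>v\<close> of the minor \<open>H\<close>;
  vertices in no branch set are deleted.
\<close>

definition is_minor :: "'b graph \<Rightarrow> 'a graph \<Rightarrow> bool" where
  "is_minor H G \<longleftrightarrow> (\<exists>B.
     (\<forall>v\<in>verts H. B v \<subseteq> verts G \<and> connected_graph (induced_subgraph G (B v))) \<and>
     (\<forall>u\<in>verts H. \<forall>v\<in>verts H. u \<noteq> v \<longrightarrow> B u \<inter> B v = {}) \<and>
     (\<forall>u v. {u, v} \<in> edges H \<longrightarrow> (\<exists>x\<in>B u. \<exists>y\<in>B v. {x, y} \<in> edges G)))"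

definition complete_graph :: "nat \<Rightarrow> nat graph" where
  "complete_graph h = \<lparr>verts = {..<h}, edges = {e. e \<subseteq> {..<h} \<and> card e = 2}\<rparr>"

text \<open>For a finite graph the maximum exists: \<open>h\<close> is at most the number of vertices.\<close>

definition Had :: "'a graph \<Rightarrow> nat" where
  "Had G = (GREATEST h. is_minor (complete_graph h) G)"

end

theory Submission
  imports Defs "HOL-Library.Disjoint_Sets"
begin

text \<open>
  Three inequivalent rays of the limit, separated by a finite set, show that for large \<open>j\<close> the
  ball of radius \<open>k\<close> around the vertex 1 of \<open>G j\<close> cuts the ball of any prescribed larger radius
  \<open>R\<close> into at least three pieces reaching distance \<open>R\<close>. By edge-transitivity this holds around
  vertices at distance at most 1 from any given one, so that suitable larger balls have
  arbitrarily many, say \<open>N\<close>, such pieces. Partition \<open>G j\<close> into Voronoi cells around a maximal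
  set of well-separated translates of 1. Each piece at a centre contains a whole cell adjacent to
  the cell of that centre, and distinct pieces contain distinct ones. Contracting the cells
  therefore yields a minor of minimum degree at least \<open>N\<close>, and large minimum degree forces a
  large clique minor by Mader's theorem.
\<close>

section \<open>Dense families of connected sets\<close>

text \<open>A finite graph has no ends, and pointwise convergence transfers only finite portions of
  the limit. This fixes the order of the quantifiers: \<open>k\<close> depends on the number of
  branches, \<open>R\<close> is free beyond \<open>k\<close>, and only then is \<open>j\<close>
  taken large. The labels make this uniform in \<open>j\<close>: with degrees at most
  \<open>D\<close>, a bound on distances from 1 and a bound on labels imply each other with
  constants that do not mention the graph. Three directions are what starts the growth. At a new
  centre one of them may lead back, and two remain to replace the branch that was followed, a net
  gain of one. With two directions nothing is gained, as for cycles converging to a double ray. An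
  edge-transitive graph need not be vertex-transitive, so the translates of 1 may miss vertices; the
  detour of length at most 1 to a translate accounts for small summands in the radii.\<close>

definition connected_in :: "('a \<times> 'a) set \<Rightarrow> 'a set \<Rightarrow> bool" where
  "connected_in E A \<longleftrightarrow> A \<noteq> {} \<and> (\<forall>u\<in>A. \<forall>v\<in>A. (u, v) \<in> (Restr E A)\<^sup>*)"

definition touch :: "('a \<times> 'a) set \<Rightarrow> 'a set \<Rightarrow> 'a set \<Rightarrow> bool" where
  "touch E A B \<longleftrightarrow> (\<exists>x\<in>A. \<exists>y\<in>B. (x, y) \<in> E)"

text \<open>The pairs are ordered, so \<open>card (touching_pairs E F) / card F\<close> is the
  average degree of the graph on \<open>F\<close> given by \<open>touch\<close>.\<close>

definition touching_pairs :: "('a \<times> 'a) set \<Rightarrow> 'a set set \<Rightarrow> ('a set \<times> 'a set) set" where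
  "touching_pairs E F = {(A, B). A \<in> F \<and> B \<in> F \<and> A \<noteq> B \<and> touch E A B}"

definition branch_family :: "('a \<times> 'a) set \<Rightarrow> 'a set set \<Rightarrow> bool" where
  "branch_family E F \<longleftrightarrow> finite F \<and> (\<forall>A\<in>F. connected_in E A) \<and> disjoint F"

lemma Restr_rtrancl_mono: "(u, v) \<in> (Restr E A)\<^sup>* \<Longrightarrow> A \<subseteq> B \<Longrightarrow> (u, v) \<in> (Restr E B)\<^sup>*"
  by (rule subsetD[OF rtrancl_mono]) auto

lemma Restr_rtrancl_sym: "sym E \<Longrightarrow> (u, v) \<in> (Restr E A)\<^sup>* \<Longrightarrow> (v, u) \<in> (Restr E A)\<^sup>*"
  by (rule symD[OF sym_rtrancl]) (auto simp: sym_def)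

lemma touch_sym: "sym E \<Longrightarrow> touch E A B \<Longrightarrow> touch E B A"
  unfolding touch_def sym_def by blast

lemma touch_mono: "touch E A B \<Longrightarrow> A \<subseteq> A' \<Longrightarrow> B \<subseteq> B' \<Longrightarrow> touch E A' B'"
  unfolding touch_def by blast

lemma touch_Un: "touch E (A \<union> B) X \<longleftrightarrow> touch E A X \<or> touch E B X"
  unfolding touch_def by blast

lemma connected_in_Un:
  assumes "sym E" "connected_in E A" "connected_in E B" "touch E A B"
  shows "connected_in E (A \<union> B)"
proof -
  obtain x y where xy: "x \<in> A" "y \<in> B" "(x, y) \<in> E"
    using assms(4) unfolding touch_def by blast
  have A: "(u, v) \<in> (Restr E (A \<union> B))\<^sup>*" if "u \<in> A" "v \<in> A" for u v
    using assms(2) that unfolding connected_in_def by (blast intro: Restr_rtrancl_mono[where A = A])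
  have B: "(u, v) \<in> (Restr E (A \<union> B))\<^sup>*" if "u \<in> B" "v \<in> B" for u v
    using assms(3) that unfolding connected_in_def by (blast intro: Restr_rtrancl_mono[where A = B])
  have AB: "(x, y) \<in> (Restr E (A \<union> B))\<^sup>*"
    using xy by blast
  have "(u, x) \<in> (Restr E (A \<union> B))\<^sup>*" if "u \<in> A \<union> B" for u
  proof (cases "u \<in> A")
    case True then show ?thesis using A xy by blast
  next
    case False
    then have "(u, y) \<in> (Restr E (A \<union> B))\<^sup>*" using B xy that by blast
    then show ?thesis using Restr_rtrancl_sym[OF assms(1) AB] by (rule rtrancl_trans)
  qed
  then have "(u, v) \<in> (Restr E (A \<union> B))\<^sup>*" if "u \<in> A \<union> B" "v \<in> A \<union> B" for u v
    using that Restr_rtrancl_sym[OF assms(1)] rtrancl_trans by metis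
  then show ?thesis
    unfolding connected_in_def using xy by blast
qed

text \<open>Contraction of an edge: the neighbours of \<open>A \<union> B\<close> are those of
  \<open>A\<close> together with those of \<open>B\<close>. Only common neighbours lose an edge,
  counted twice because pairs are ordered, and the edge between \<open>A\<close> and
  \<open>B\<close> accounts for the final 2.\<close>

lemma touching_pairs_merge:
  assumes E: "sym E" and F: "branch_family E F" and AB: "A \<in> F" "B \<in> F" "A \<noteq> B"
  defines "C \<equiv> {X \<in> F - {A, B}. touch E A X \<and> touch E B X}"
  shows "card (touching_pairs E F)
    \<le> card (touching_pairs E (insert (A \<union> B) (F - {A, B}))) + 2 * card C + 2"
proof -
  define F0 where "F0 = F - {A, B}"
  define P where "P = touching_pairs E F0"
  define nA where "nA = {X \<in> F0. touch E A X}"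
  define nB where "nB = {X \<in> F0. touch E B X}"
  define QA where "QA = {A} \<times> nA \<union> nA \<times> {A}"
  define QB where "QB = {B} \<times> nB \<union> nB \<times> {B}"
  have fin: "finite F" "finite F0" "finite nA" "finite nB"
    using F unfolding branch_family_def F0_def nA_def nB_def by auto
  have finQ: "finite QA" "finite QB" using fin unfolding QA_def QB_def by auto
  have "P \<subseteq> F0 \<times> F0" unfolding P_def touching_pairs_def by auto
  then have finP: "finite P" using fin by (meson finite_SigmaI finite_subset)
  have ne: "A \<noteq> {}" "B \<noteq> {}"
    using F AB unfolding branch_family_def connected_in_def by auto
  \<comment> \<open>The merged set is new, so pairs containing it are not already counted in
    \<open>P\<close>.\<close>
  have D: "A \<union> B \<notin> F0"
  proof
    assume "A \<union> B \<in> F0"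
    then have "A \<union> B \<in> F" "A \<union> B \<noteq> A" unfolding F0_def by auto
    then have "(A \<union> B) \<inter> A = {}"
      using F AB(1) unfolding branch_family_def by (metis disjointD)
    then show False using ne by blast
  qed
  have "touching_pairs E F \<subseteq>
      P \<union> ({A} \<times> nA \<union> nA \<times> {A}) \<union> ({B} \<times> nB \<union> nB \<times> {B}) \<union> {(A, B), (B, A)}"
  proof
    fix p assume p: "p \<in> touching_pairs E F"
    then obtain X Y where XY: "p = (X, Y)" "X \<in> F" "Y \<in> F" "X \<noteq> Y" "touch E X Y" "touch E Y X"
      using touch_sym[OF E] unfolding touching_pairs_def by blast
    then show "p \<in> P \<union> ({A} \<times> nA \<union> nA \<times> {A}) \<union> ({B} \<times> nB \<union> nB \<times> {B}) \<union> {(A, B), (B, A)}"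
      unfolding touching_pairs_def P_def nA_def nB_def F0_def
      by (cases "X = A"; cases "X = B"; cases "Y = A"; cases "Y = B") simp_all
  qed
  then have "touching_pairs E F \<subseteq> P \<union> QA \<union> QB \<union> {(A, B), (B, A)}"
    unfolding QA_def QB_def by simp
  then have "card (touching_pairs E F) \<le> card (P \<union> QA \<union> QB \<union> {(A, B), (B, A)})"
    using finP finQ by (intro card_mono) simp_all
  moreover have "card QA \<le> 2 * card nA"
    using card_Un_le[of "{A} \<times> nA" "nA \<times> {A}"] unfolding QA_def
    by (simp add: card_cartesian_product)
  moreover have "card QB \<le> 2 * card nB"
    using card_Un_le[of "{B} \<times> nB" "nB \<times> {B}"] unfolding QB_def
    by (simp add: card_cartesian_product)
  moreover have "card {(A, B), (B, A)} \<le> 2"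
    using card_length[of "[(A, B), (B, A)]"] by simp
  ultimately have up: "card (touching_pairs E F) \<le> card P + 2 * card nA + 2 * card nB + 2"
    using card_Un_le[of P QA] card_Un_le[of "P \<union> QA" QB]
      card_Un_le[of "P \<union> QA \<union> QB" "{(A, B), (B, A)}"] by linarith
  have "card P + (card (nA \<union> nB) + card (nA \<union> nB)) =
      card (P \<union> ({A \<union> B} \<times> (nA \<union> nB) \<union> (nA \<union> nB) \<times> {A \<union> B}))"
  proof -
    have "P \<inter> ({A \<union> B} \<times> (nA \<union> nB) \<union> (nA \<union> nB) \<times> {A \<union> B}) = {}"
      using \<open>P \<subseteq> F0 \<times> F0\<close> D by blast
    moreover have "({A \<union> B} \<times> (nA \<union> nB)) \<inter> ((nA \<union> nB) \<times> {A \<union> B}) = {}"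
      using D unfolding nA_def nB_def by blast
    ultimately show ?thesis
      using fin finP by (simp add: card_Un_disjoint card_cartesian_product)
  qed
  also have "\<dots> \<le> card (touching_pairs E (insert (A \<union> B) F0))"
  proof (intro card_mono)
    have "touching_pairs E (insert (A \<union> B) F0) \<subseteq> insert (A \<union> B) F0 \<times> insert (A \<union> B) F0"
      unfolding touching_pairs_def by auto
    then show "finite (touching_pairs E (insert (A \<union> B) F0))"
      using fin by (meson finite_SigmaI finite_insert finite_subset)
    show "P \<union> ({A \<union> B} \<times> (nA \<union> nB) \<union> (nA \<union> nB) \<times> {A \<union> B})
        \<subseteq> touching_pairs E (insert (A \<union> B) F0)"
    proof -
      have "touch E X (A \<union> B)" if "touch E A X \<or> touch E B X" for X
        using that touch_sym[OF E] touch_Un by metis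
      then show ?thesis
        using D unfolding P_def touching_pairs_def nA_def nB_def by (auto simp: touch_Un)
    qed
  qed
  finally have low: "card P + 2 * card (nA \<union> nB) \<le> card (touching_pairs E (insert (A \<union> B) F0))"
    by simp
  have "C = nA \<inter> nB" unfolding C_def nA_def nB_def F0_def by auto
  then have "card nA + card nB = card (nA \<union> nB) + card C"
    using card_Un_Int fin by metis
  then show ?thesis using up low unfolding F0_def by simp
qed

text \<open>Mader's argument: merge touching sets as long as this does not lower the density;
  afterwards the neighbours of any non-isolated set form a dense family.\<close>

lemma dense_family_clique:
  assumes E: "sym E"
  shows "branch_family E F \<Longrightarrow> F \<noteq> {} \<Longrightarrow> 2 ^ Suc h * card F \<le> card (touching_pairs E F) \<Longrightarrow>
    \<exists>K. branch_family E K \<and> card K = h \<and> (\<forall>A\<in>K. \<forall>B\<in>K. A \<noteq> B \<longrightarrow> touch E A B) \<and>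
      (\<forall>B\<in>K. B \<subseteq> \<Union>F \<and> (\<exists>A\<in>F. A \<subseteq> B))"
proof (induction h arbitrary: F)
  case 0
  show ?case by (rule exI[of _ "{}"]) (auto simp: branch_family_def disjoint_def)
next
  case (Suc h)
  note IH = Suc.IH
  from Suc.prems show ?case
  proof (induction "card F" arbitrary: F rule: less_induct)
    case less
    have fin: "finite F" and conn: "\<And>A. A \<in> F \<Longrightarrow> connected_in E A"
      and disj: "\<And>A B. A \<in> F \<Longrightarrow> B \<in> F \<Longrightarrow> A \<noteq> B \<Longrightarrow> A \<inter> B = {}"
      using less.prems unfolding branch_family_def disjoint_def by auto
    define C where "C A B = {X \<in> F - {A, B}. touch E A X \<and> touch E B X}" for A B
    have finC: "finite (C A B)" for A B using fin unfolding C_def by auto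
    show ?case
    proof (cases "\<exists>(A, B)\<in>touching_pairs E F. card (C A B) < 2 ^ Suc h")
      case True
      then obtain A B where AB: "A \<in> F" "B \<in> F" "A \<noteq> B" "touch E A B"
        and small: "card (C A B) < 2 ^ Suc h"
        unfolding touching_pairs_def by auto
      let ?F = "insert (A \<union> B) (F - {A, B})"
      have U: "\<Union>?F = \<Union>F" using AB by auto
      have bf: "branch_family E ?F"
        unfolding branch_family_def
      proof (intro conjI)
        show "\<forall>X\<in>?F. connected_in E X"
          using conn connected_in_Un[OF E conn conn AB(4)] AB by simp
        have "(A \<union> B) \<inter> X = {}" if "X \<in> F - {A, B}" for X
          using that disj[of A X] disj[of B X] AB by auto
        moreover have "disjoint (F - {A, B})"
          using disj unfolding disjoint_def by simp
        ultimately show "disjoint ?F"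
          unfolding pairwise_insert disjnt_def by (simp add: Int_commute)
      qed (use fin in simp)
      have "card ?F \<le> card (F - {A, B}) + 1"
        using card_insert_le_m1 fin by (simp add: card_insert_if)
      moreover have "card (F - {A, B}) + 2 = card F"
        using AB fin card_mono[of F "{A, B}"] by (subst card_Diff_subset) auto
      ultimately have cF: "card ?F + 1 \<le> card F" by simp
      \<comment> \<open>With fewer than \<open>2 ^ Suc h\<close> common neighbours, the loss
        \<open>2 * card (C A B) + 2\<close> is at most \<open>2 ^ Suc (Suc h)\<close>, which is just
        what the density bound grants for one set less.\<close>
      have "2 ^ Suc (Suc h) * card ?F + 2 ^ Suc (Suc h) \<le> 2 ^ Suc (Suc h) * card F"
        using mult_le_mono2[OF cF, of "2 ^ Suc (Suc h)"] by simp
      also have "\<dots> \<le> card (touching_pairs E ?F) + 2 * card (C A B) + 2"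
        using less.prems(3) touching_pairs_merge[OF E less.prems(1) AB(1-3)]
        unfolding C_def by linarith
      finally have "2 ^ Suc (Suc h) * card ?F \<le> card (touching_pairs E ?F)"
        using small by simp
      moreover have "card ?F < card F" "?F \<noteq> {}" using cF by simp_all
      ultimately obtain K where
        "branch_family E K" "card K = Suc h" "\<forall>A\<in>K. \<forall>B\<in>K. A \<noteq> B \<longrightarrow> touch E A B"
        "\<forall>B\<in>K. B \<subseteq> \<Union>?F \<and> (\<exists>A\<in>?F. A \<subseteq> B)"
        using less.hyps[OF _ bf] by metis
      moreover have "\<exists>X\<in>F. X \<subseteq> Y" if "X \<in> ?F" "X \<subseteq> Y" for X Y
        using that AB(1) by (metis DiffE insertE le_sup_iff)
      ultimately show ?thesis unfolding U by metis
    next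
      case False
      have "touching_pairs E F \<noteq> {}"
        using less.prems(2,3) fin by (auto simp: card_gt_0_iff)
      then obtain A B where AB: "A \<in> F" "B \<in> F" "A \<noteq> B" "touch E A B"
        unfolding touching_pairs_def by auto
      \<comment> \<open>Every touching pair now has at least \<open>2 ^ Suc h\<close> common
        neighbours, so each set in \<open>N\<close> touches that many others in \<open>N\<close>.
        Half the density remains, as the case \<open>h\<close> demands, and \<open>A\<close> is
        added to the clique found there.\<close>
      define N where "N = {X \<in> F. X \<noteq> A \<and> touch E A X}"
      have NF: "N \<subseteq> F" and B: "B \<in> N" using AB unfolding N_def by auto
      then have finN: "finite N" using fin finite_subset by blast
      have bfN: "branch_family E N"
        using less.prems(1) NF finN unfolding branch_family_def disjoint_def by blast
      have eq: "touching_pairs E N = (SIGMA X:N. C A X)"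
        unfolding touching_pairs_def N_def C_def by auto
      have "card (touching_pairs E N) = (\<Sum>X\<in>N. card (C A X))"
        unfolding eq using finN finC by simp
      moreover have "2 ^ Suc h \<le> card (C A X)" if "X \<in> N" for X
        using False that AB(1) unfolding N_def touching_pairs_def by force
      ultimately have "2 ^ Suc h * card N \<le> card (touching_pairs E N)"
        using sum_mono[of N "\<lambda>_. 2 ^ Suc h" "\<lambda>X. card (C A X)"] by (simp add: mult.commute)
      moreover have "N \<noteq> {}" using B by blast
      ultimately obtain K where K: "branch_family E K" "card K = h"
        "\<forall>A\<in>K. \<forall>B\<in>K. A \<noteq> B \<longrightarrow> touch E A B"
        "\<forall>B\<in>K. B \<subseteq> \<Union>N \<and> (\<exists>A\<in>N. A \<subseteq> B)"
        using IH[OF bfN] by metis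
      have AN: "A \<inter> \<Union>N = {}" using disj AB(1) unfolding N_def by blast
      then have AK: "A \<inter> X = {}" if "X \<in> K" for X using K(4) that by blast
      have "A \<noteq> {}" using conn AB unfolding connected_in_def by auto
      then have "A \<notin> K" using AK by blast
      \<comment> \<open>A set in \<open>K\<close> may be a union of several sets of
        \<open>N\<close>. It contains at least one of them, hence touches \<open>A\<close>; the last
        conjunct of the induction serves this purpose.\<close>
      have tAK: "touch E A X" if X: "X \<in> K" for X
      proof -
        obtain Y where "Y \<in> N" "Y \<subseteq> X" using K(4) X by blast
        then show ?thesis using touch_mono[of E A Y A X] unfolding N_def by auto
      qed
      show ?thesis
      proof (intro exI[of _ "insert A K"] conjI)
        show "branch_family E (insert A K)"
          using K(1) conn[OF AB(1)] AK unfolding branch_family_def disjoint_def by auto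
        show "card (insert A K) = Suc h"
          using K \<open>A \<notin> K\<close> unfolding branch_family_def by simp
        show "\<forall>X\<in>insert A K. \<forall>Y\<in>insert A K. X \<noteq> Y \<longrightarrow> touch E X Y"
          using K(3) tAK touch_sym[OF E] by blast
        show "\<forall>X\<in>insert A K. X \<subseteq> \<Union>F \<and> (\<exists>A\<in>F. A \<subseteq> X)"
          using K(4) NF AB(1) by blast
      qed
    qed
  qed
qed

section \<open>Distances and branching\<close>

lemma adj_sym: "sym (adj G)"
  unfolding adj_def sym_def by (auto simp: insert_commute)

lemma adjD:
  assumes "simple_graph G" "(u, v) \<in> adj G"
  shows "u \<in> verts G" "v \<in> verts G" "u \<noteq> v"
  using assms unfolding simple_graph_def adj_def by (auto simp: card_2_iff doubleton_eq_iff)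

definition shell :: "'a graph \<Rightarrow> 'a \<Rightarrow> nat \<Rightarrow> nat \<Rightarrow> 'a set" where
  "shell G c k R = {v \<in> verts G. k < graph_dist G c v \<and> graph_dist G c v \<le> R}"

text \<open>A finitary substitute for having \<open>N\<close> ends beyond the ball of radius \<open>k\<close>: it only depends
  on the ball of radius \<open>R\<close>.\<close>

definition branching :: "'a graph \<Rightarrow> 'a \<Rightarrow> nat \<Rightarrow> nat \<Rightarrow> nat \<Rightarrow> bool" where
  "branching G c N k R \<longleftrightarrow> (\<exists>A. finite A \<and> card A = N \<and>
     A \<subseteq> {v \<in> verts G. graph_dist G c v = R} \<and>
     (\<forall>a\<in>A. \<forall>b\<in>A. a \<noteq> b \<longrightarrow> (a, b) \<notin> (Restr (adj G) (shell G c k R))\<^sup>*))"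

locale finite_connected_graph =
  fixes G :: "'a graph"
  assumes simple: "simple_graph G" and connected: "connected_graph G"
    and finite_verts: "finite (verts G)"
begin

abbreviation "V \<equiv> verts G"
abbreviation "E \<equiv> adj G"
abbreviation "d \<equiv> graph_dist G"

lemma E_commute: "(u, v) \<in> E \<longleftrightarrow> (v, u) \<in> E"
  using adj_sym by (metis symD)

lemma path_commute: "(u, v) \<in> (Restr E W)\<^sup>* \<longleftrightarrow> (v, u) \<in> (Restr E W)\<^sup>*"
  using Restr_rtrancl_sym[OF adj_sym] by metis

lemma dist_path:
  assumes "u \<in> V" "v \<in> V" shows "(u, v) \<in> E ^^ d u v"
proof -
  have "\<exists>k. (u, v) \<in> E ^^ k"
    using connected assms unfolding connected_graph_def by (metis rtrancl_imp_relpow)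
  then show ?thesis unfolding graph_dist_def by (rule LeastI_ex)
qed

lemma dist_le: "(u, v) \<in> E ^^ k \<Longrightarrow> d u v \<le> k"
  unfolding graph_dist_def by (rule Least_le)

lemma dist_self [simp]: "d u u = 0"
  using dist_le[of u u 0] by simp

lemma dist_eq_0: "u \<in> V \<Longrightarrow> v \<in> V \<Longrightarrow> d u v = 0 \<Longrightarrow> u = v"
  using dist_path[of u v] by simp

lemma dist_triangle: "u \<in> V \<Longrightarrow> v \<in> V \<Longrightarrow> w \<in> V \<Longrightarrow> d u w \<le> d u v + d v w"
  by (rule dist_le) (auto simp: relpow_add intro: dist_path)

lemma dist_commute:
  assumes "u \<in> V" "v \<in> V" shows "d u v = d v u"
proof -
  have "(v, u) \<in> E ^^ n" if "(u, v) \<in> E ^^ n" for u v n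
    using that
  proof (induction n arbitrary: v)
    case (Suc n)
    then obtain w where "(u, w) \<in> E ^^ n" "(w, v) \<in> E" by auto
    then show ?case using Suc.IH E_commute relpow_Suc_I2 by metis
  qed simp
  then show ?thesis using dist_path dist_le assms by (metis antisym)
qed

lemma dist_adj: "(u, v) \<in> E \<Longrightarrow> d u v \<le> 1"
  by (rule dist_le) simp

lemma dist_step: "c \<in> V \<Longrightarrow> (u, v) \<in> E \<Longrightarrow> d c v \<le> d c u + 1"
  using dist_triangle[of c u v] adjD[OF simple] dist_adj[of u v] by fastforce

lemma dist_pred:
  assumes "c \<in> V" "v \<in> V" "d c v = Suc n"
  obtains u where "u \<in> V" "(u, v) \<in> E" "d c u = n"
proof -
  have "(c, v) \<in> E ^^ Suc n" using dist_path assms by metis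
  then obtain u where u: "(c, u) \<in> E ^^ n" "(u, v) \<in> E" by auto
  then have "d c u \<le> n" "u \<in> V" using dist_le adjD[OF simple] by auto
  moreover have "Suc n \<le> d c u + 1" using dist_step assms u by metis
  ultimately show ?thesis using u that by simp
qed

text \<open>The final part of a shortest path from \<open>c\<close> to \<open>v\<close>. Recording
  the range of distances allows it to be placed in a shell.\<close>

lemma geodesic:
  assumes "c \<in> V" "v \<in> V" "m \<le> d c v"
  shows "\<exists>u\<in>V. d c u = m \<and> (u, v) \<in> (Restr E {x \<in> V. m \<le> d c x \<and> d c x \<le> d c v})\<^sup>*"
  using assms(2,3)
proof (induction "d c v - m" arbitrary: v)
  case 0 then show ?case by auto
next
  case (Suc n)
  then obtain l where l: "d c v = Suc l" "m \<le> l" by (cases "d c v") auto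
  then obtain w where w: "w \<in> V" "(w, v) \<in> E" "d c w = l"
    using dist_pred assms(1) Suc.prems by metis
  then obtain u where u: "u \<in> V" "d c u = m"
    "(u, w) \<in> (Restr E {x \<in> V. m \<le> d c x \<and> d c x \<le> d c w})\<^sup>*"
    using Suc.hyps(1)[of w] Suc.hyps(2) l by fastforce
  have "(u, w) \<in> (Restr E {x \<in> V. m \<le> d c x \<and> d c x \<le> d c v})\<^sup>*"
    by (rule Restr_rtrancl_mono[OF u(3)]) (use w l in auto)
  then have "(u, v) \<in> (Restr E {x \<in> V. m \<le> d c x \<and> d c x \<le> d c v})\<^sup>*"
    by (rule rtrancl_into_rtrancl) (use w l Suc.prems in auto)
  then show ?case using u by auto
qed

text \<open>Stores in the vertex set the fact that each vertex of the path still reaches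
  \<open>v\<close>, so that it survives when \<open>path_crossing\<close> cuts the path
  short.\<close>

lemma path_into_component:
  assumes "(u, v) \<in> (Restr E Z)\<^sup>*"
  shows "(u, v) \<in> (Restr E {x \<in> Z. (x, v) \<in> (Restr E Z)\<^sup>*})\<^sup>*"
  using assms
proof (induction rule: converse_rtrancl_induct)
  case base show ?case by simp
next
  case (step y z)
  then have "(y, v) \<in> (Restr E Z)\<^sup>*" by (meson converse_rtrancl_into_rtrancl)
  then show ?case using step by (intro converse_rtrancl_into_rtrancl[OF _ step.IH]) auto
qed

text \<open>A discrete intermediate value argument: along an edge the distance from \<open>c\<close>
  rises by at most 1, so \<open>w\<close> is the first vertex of the path at distance
  \<open>R\<close>.\<close>

lemma path_crossing:
  assumes "(u, v) \<in> (Restr E Z)\<^sup>*" "c \<in> V" "u \<in> V" "d c u \<le> R" "R \<le> d c v"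
  shows "\<exists>w\<in>V. d c w = R \<and> (u, w) \<in> (Restr E {x \<in> Z. d c x \<le> R})\<^sup>* \<and> (w, v) \<in> (Restr E Z)\<^sup>*"
  using assms(1,3,4)
proof (induction rule: converse_rtrancl_induct)
  case base then show ?case using assms(5) by auto
next
  case (step y z)
  then have zV: "z \<in> V" using adjD[OF simple] by blast
  show ?case
  proof (cases "d c y = R")
    case True
    have "(y, v) \<in> (Restr E Z)\<^sup>*" using step.hyps by (rule converse_rtrancl_into_rtrancl)
    then show ?thesis using True step.prems by blast
  next
    case False
    then have "d c z \<le> R" using dist_step[of c y z] step assms(2) by force
    then obtain w where w: "w \<in> V" "d c w = R" "(z, w) \<in> (Restr E {x \<in> Z. d c x \<le> R})\<^sup>*"
        "(w, v) \<in> (Restr E Z)\<^sup>*"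
      using step.IH zV by auto
    have "(y, w) \<in> (Restr E {x \<in> Z. d c x \<le> R})\<^sup>*"
      using step \<open>d c z \<le> R\<close> by (intro converse_rtrancl_into_rtrancl[OF _ w(3)]) auto
    then show ?thesis using w by blast
  qed
qed

end

section \<open>Increasing the number of branches\<close>

context finite_connected_graph
begin

lemma path_in_ball:
  assumes "c \<in> V" "x \<in> V" "d c x \<le> k"
  shows "(c, x) \<in> (Restr E {y \<in> V. d c y \<le> k})\<^sup>*"
proof -
  obtain u where u: "u \<in> V" "d c u = 0" "(u, x) \<in> (Restr E {y \<in> V. 0 \<le> d c y \<and> d c y \<le> d c x})\<^sup>*"
    using geodesic[OF assms(1,2), of 0] by auto
  then have "u = c" using dist_eq_0[OF assms(1), of u] by simp
  moreover have "(u, x) \<in> (Restr E {y \<in> V. d c y \<le> k})\<^sup>*"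
    by (rule Restr_rtrancl_mono[OF u(3)]) (use assms(3) in auto)
  ultimately show ?thesis by simp
qed

text \<open>Move from \<open>s\<close> towards some \<open>a\<close> of the given \<open>N\<close> vertices until a centre \<open>w\<close> whose ball
  of radius \<open>r\<close> avoids the ball of radius \<open>k\<close>. Of the three directions at \<open>w\<close>, at most one leads
  back to \<open>s\<close>; replace \<open>a\<close> by vertices in two others.\<close>

lemma branching_Suc:
  assumes N: "branching G s N k R" "N > 0"
    and s: "s \<in> V"
    and near: "\<And>v. v \<in> V \<Longrightarrow> \<exists>w\<in>Q. w = v \<or> (v, w) \<in> E"
    and Q: "\<And>w. w \<in> Q \<Longrightarrow> w \<in> V \<and> branching G w 3 r (R + k + r + 4)"
    and R: "k + 2 * r + 5 \<le> R"
  shows "branching G s (Suc N) (k + 2 * r + 4) R"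
proof -
  let ?W = "shell G s k R"
  obtain A where A: "finite A" "card A = N" "A \<subseteq> {v \<in> V. d s v = R}"
    and Asep: "\<And>a b. a \<in> A \<Longrightarrow> b \<in> A \<Longrightarrow> a \<noteq> b \<Longrightarrow> (a, b) \<notin> (Restr E ?W)\<^sup>*"
    using N(1) unfolding branching_def by blast
  obtain a where a: "a \<in> A" using A N(2) by (metis card_gt_0_iff ex_in_conv)
  then have aV: "a \<in> V" "d s a = R" using A by auto
  \<comment> \<open>The centre \<open>w\<close> may lie one step off \<open>p\<close>. At distance
    at least \<open>k + r + 2\<close> from \<open>s\<close>, its ball of radius \<open>r + 1\<close>
    still misses the ball of radius \<open>k\<close> around \<open>s\<close>.\<close>
  obtain p where p: "p \<in> V" "d s p = k + r + 3"
      "(p, a) \<in> (Restr E {x \<in> V. k + r + 3 \<le> d s x \<and> d s x \<le> d s a})\<^sup>*"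
    using geodesic[OF s aV(1), of "k + r + 3"] aV R by auto
  have pa: "(p, a) \<in> (Restr E ?W)\<^sup>*"
    by (rule Restr_rtrancl_mono[OF p(3)]) (auto simp: shell_def aV)
  obtain w where w: "w \<in> Q" "w = p \<or> (p, w) \<in> E" using near[OF p(1)] by blast
  have wV: "w \<in> V" using Q w by blast
  define m where "m = d s w"
  have m: "k + r + 2 \<le> m" "m \<le> k + r + 4"
    using w(2) p(2) dist_step[OF s, of p w] dist_step[OF s, of w p] E_commute[of p w]
    unfolding m_def by auto
  have dwo: "d w s = m" using dist_commute[OF wV s] m_def by simp
  have wp: "(w, p) \<in> (Restr E ?W)\<^sup>*"
  proof -
    have "p \<in> ?W" "w \<in> ?W" using p wV m R unfolding shell_def m_def by auto
    then show ?thesis using w(2) E_commute[of p w] by auto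
  qed
  have wa: "(w, a) \<in> (Restr E ?W)\<^sup>*" using wp pa by (rule rtrancl_trans)
  \<comment> \<open>As \<open>w\<close> is at most \<open>k + r + 4\<close> away from
    \<open>s\<close>, vertices at distance \<open>R + k + r + 4\<close> from \<open>w\<close> are at
    distance at least \<open>R\<close> from \<open>s\<close>, and the \<open>R\<close>-ball of
    \<open>s\<close> stays within the outer radius of \<open>Z\<close>.\<close>
  define Z where "Z = shell G w r (R + k + r + 4)"
  obtain B where B: "card B = 3" "B \<subseteq> {v \<in> V. d w v = R + k + r + 4}"
    and Bsep: "\<And>a b. a \<in> B \<Longrightarrow> b \<in> B \<Longrightarrow> a \<noteq> b \<Longrightarrow> (a, b) \<notin> (Restr E Z)\<^sup>*"
    using Q[OF w(1)] unfolding branching_def Z_def by blast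
  have sB: "(s, b) \<notin> (Restr E Z)\<^sup>* \<or> (s, b') \<notin> (Restr E Z)\<^sup>*"
    if "b \<in> B" "b' \<in> B" "b \<noteq> b'" for b b'
    using Bsep[OF that] path_commute[of s b Z] by (meson rtrancl_trans)
  obtain b1 b2 where b: "b1 \<in> B" "b2 \<in> B" "b1 \<noteq> b2"
    "(s, b1) \<notin> (Restr E Z)\<^sup>*" "(s, b2) \<notin> (Restr E Z)\<^sup>*"
  proof -
    obtain x y z where "B = {x, y, z}" "x \<noteq> y" "y \<noteq> z" "x \<noteq> z" using B(1) by (metis card_3_iff)
    then show ?thesis using sB[of x y] sB[of x z] sB[of y z] that by blast
  qed
  \<comment> \<open>The whole \<open>k\<close>-ball of \<open>s\<close> lies in \<open>Z\<close> and
    is joined to \<open>s\<close> there. Hence a component of \<open>Z\<close> that \<open>s\<close>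
    does not reach misses this ball.\<close>
  have sZ: "(s, x) \<in> (Restr E Z)\<^sup>*" if x: "x \<in> V" "d s x \<le> k" for x
  proof (rule Restr_rtrancl_mono[OF path_in_ball[OF s x]], rule subsetI)
    fix y assume y: "y \<in> {y \<in> V. d s y \<le> k}"
    then have "m \<le> d w y + d s y" "d w y \<le> m + d s y"
      using dist_triangle[of w y s] dist_triangle[of w s y] dist_commute[of s y] wV s dwo by auto
    then show "y \<in> Z" using y m R unfolding Z_def shell_def by auto
  qed
  \<comment> \<open>Walk from \<open>w\<close> towards \<open>b\<close> and stop at the first vertex
    \<open>c\<close> at distance \<open>R\<close> from \<open>s\<close>. The walk misses the
    \<open>k\<close>-ball of \<open>s\<close>, so it stays in \<open>?W\<close> and \<open>c\<close>
    inherits from \<open>a\<close> the separation from the rest of \<open>A\<close>.\<close>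
  have branch: "\<exists>c\<in>V. d s c = R \<and> (c, b) \<in> (Restr E Z)\<^sup>* \<and> (c, a) \<in> (Restr E ?W)\<^sup>*"
    if bB: "b \<in> B" and bo: "(s, b) \<notin> (Restr E Z)\<^sup>*" for b
  proof -
    have bV: "b \<in> V" "d w b = R + k + r + 4" using B bB by auto
    have Rb: "R \<le> d s b"
      using dist_triangle[OF wV s bV(1)] dwo bV m by linarith
    obtain u where u: "u \<in> V" "d w u = r + 1"
      "(u, b) \<in> (Restr E {x \<in> V. r + 1 \<le> d w x \<and> d w x \<le> d w b})\<^sup>*"
      using geodesic[OF wV bV(1), of "r + 1"] bV R by auto
    have "(u, b) \<in> (Restr E Z)\<^sup>*"
      by (rule Restr_rtrancl_mono[OF u(3)]) (auto simp: Z_def shell_def bV)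
    then have ub: "(u, b) \<in> (Restr E {x \<in> Z. (x, b) \<in> (Restr E Z)\<^sup>*})\<^sup>*"
      by (rule path_into_component)
    have "d s u \<le> R"
      using dist_triangle[OF s wV u(1)] u(2) m R unfolding m_def by linarith
    from path_crossing[OF ub s u(1) this Rb] obtain c where c: "c \<in> V" "d s c = R"
      "(u, c) \<in> (Restr E {x \<in> {x \<in> Z. (x, b) \<in> (Restr E Z)\<^sup>*}. d s x \<le> R})\<^sup>*"
      "(c, b) \<in> (Restr E {x \<in> Z. (x, b) \<in> (Restr E Z)\<^sup>*})\<^sup>*" by blast
    have uc: "(u, c) \<in> (Restr E ?W)\<^sup>*"
    proof (rule Restr_rtrancl_mono[OF c(3)], rule subsetI)
      fix x assume x: "x \<in> {x \<in> {x \<in> Z. (x, b) \<in> (Restr E Z)\<^sup>*}. d s x \<le> R}"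
      then have "x \<in> V" unfolding Z_def shell_def by simp
      moreover have "\<not> d s x \<le> k"
        using sZ[of x] x bo \<open>x \<in> V\<close> by (auto dest: rtrancl_trans)
      ultimately show "x \<in> ?W" using x unfolding shell_def by simp
    qed
    have wu: "(w, u) \<in> (Restr E ?W)\<^sup>*"
    proof (rule Restr_rtrancl_mono[OF path_in_ball[OF wV u(1), of "r + 1"]])
      show "{y \<in> V. d w y \<le> r + 1} \<subseteq> ?W"
      proof
        fix y assume y: "y \<in> {y \<in> V. d w y \<le> r + 1}"
        then have "m \<le> d s y + d w y" "d s y \<le> m + d w y"
          using dist_triangle[of s y w] dist_triangle[of s w y] dist_commute[of w y] wV s m_def by auto
        then show "y \<in> ?W" using y m R unfolding shell_def by auto
      qed
    qed (use u in simp)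
    have "(w, c) \<in> (Restr E ?W)\<^sup>*" using wu uc by (rule rtrancl_trans)
    then have "(c, w) \<in> (Restr E ?W)\<^sup>*" by (simp only: path_commute)
    then have "(c, a) \<in> (Restr E ?W)\<^sup>*" using wa by (rule rtrancl_trans)
    moreover have "(c, b) \<in> (Restr E Z)\<^sup>*" by (rule Restr_rtrancl_mono[OF c(4)]) auto
    ultimately show ?thesis using c by blast
  qed
  obtain c1 where c1: "c1 \<in> V" "d s c1 = R" "(c1, b1) \<in> (Restr E Z)\<^sup>*" "(c1, a) \<in> (Restr E ?W)\<^sup>*"
    using branch[OF b(1,4)] by blast
  obtain c2 where c2: "c2 \<in> V" "d s c2 = R" "(c2, b2) \<in> (Restr E Z)\<^sup>*" "(c2, a) \<in> (Restr E ?W)\<^sup>*"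
    using branch[OF b(2,5)] by blast
  \<comment> \<open>The enlarged ball around \<open>s\<close> contains the \<open>r\<close>-ball
    around \<open>w\<close>. A path in \<open>?W'\<close> is therefore a path in \<open>?W\<close>
    and in \<open>Z\<close>, and both separations persist.\<close>
  let ?W' = "shell G s (k + 2 * r + 4) R"
  have W'W: "?W' \<subseteq> ?W" unfolding shell_def by auto
  have W'Z: "?W' \<subseteq> Z"
  proof
    fix y assume y: "y \<in> ?W'"
    then have yV: "y \<in> V" unfolding shell_def by auto
    have "d s y \<le> m + d w y" "d w y \<le> m + d s y"
      using dist_triangle[OF s wV yV] dist_triangle[OF wV s yV] dwo m_def by auto
    then show "y \<in> Z" using y m R unfolding Z_def shell_def by auto
  qed
  have c12: "(c1, c2) \<notin> (Restr E Z)\<^sup>*"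
  proof
    assume "(c1, c2) \<in> (Restr E Z)\<^sup>*"
    then have "(b1, b2) \<in> (Restr E Z)\<^sup>*"
      using c1(3) c2(3) path_commute by (meson rtrancl_trans)
    then show False using Bsep b by blast
  qed
  then have ne: "c1 \<noteq> c2" by blast
  have Ac: "(x, c) \<notin> (Restr E ?W)\<^sup>*" if "x \<in> A - {a}" "c = c1 \<or> c = c2" for x c
    using that Asep[of x a] a c1(4) c2(4) by (auto dest: rtrancl_trans)
  have c_notin: "c1 \<notin> A - {a}" "c2 \<notin> A - {a}" using Ac by blast+
  show ?thesis
    unfolding branching_def
  proof (intro exI[of _ "insert c1 (insert c2 (A - {a}))"] conjI ballI impI)
    show "card (insert c1 (insert c2 (A - {a}))) = Suc N"
      using A a c_notin ne N(2) by simp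
    show "insert c1 (insert c2 (A - {a})) \<subseteq> {v \<in> V. d s v = R}"
      using A c1 c2 by auto
    fix x y assume xy: "x \<in> insert c1 (insert c2 (A - {a}))" "y \<in> insert c1 (insert c2 (A - {a}))" "x \<noteq> y"
    show "(x, y) \<notin> (Restr E ?W')\<^sup>*"
    proof
      assume *: "(x, y) \<in> (Restr E ?W')\<^sup>*"
      then have W: "(x, y) \<in> (Restr E ?W)\<^sup>*" "(y, x) \<in> (Restr E ?W)\<^sup>*"
        using Restr_rtrancl_mono[OF _ W'W] path_commute by blast+
      have Z: "(x, y) \<in> (Restr E Z)\<^sup>*" "(y, x) \<in> (Restr E Z)\<^sup>*"
        using * Restr_rtrancl_mono[OF _ W'Z] path_commute by blast+
      show False using xy W Z c12 Ac Asep by blast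
    qed
  qed (use A in simp)
qed

end

section \<open>Voronoi cells\<close>

lemma path_exit:
  assumes "(u, v) \<in> (Restr E W)\<^sup>*" "P u" "\<not> P v"
  shows "\<exists>s t. P s \<and> \<not> P t \<and> (s, t) \<in> E \<and> (t, v) \<in> (Restr E W)\<^sup>*"
  using assms
proof (induction rule: converse_rtrancl_induct)
  case (step y z)
  then show ?case by (cases "P z") auto
qed blast

context finite_connected_graph
begin

text \<open>Ties are broken by a numbering \<open>i\<close> of the vertices: \<open>f v\<close> minimises \<open>n * d x v + i x\<close>
  with \<open>n\<close> larger than all values of \<open>i\<close>.\<close>

lemma voronoi_cells:
  assumes X: "X \<subseteq> V" "X \<noteq> {}"
  shows "\<exists>f. \<forall>v\<in>V. f v \<in> X \<and> (\<forall>y\<in>X. d (f v) v \<le> d y v) \<and>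
    (v, f v) \<in> (Restr E {u \<in> V. f u = f v})\<^sup>*"
proof -
  obtain i :: "'a \<Rightarrow> nat" and n where i: "i ` V = {i. i < n}" "inj_on i V"
    using finite_imp_inj_to_nat_seg[OF finite_verts] by blast
  have i_less: "i x < n" if "x \<in> X" for x using i X that by blast
  define key where "key v x = n * d x v + i x" for v x
  define f where "f v = arg_min_on (key v) X" for v
  have finX: "finite X" using X finite_verts finite_subset by blast
  have fX: "f v \<in> X" for v unfolding f_def using arg_min_if_finite(1)[OF finX X(2)] .
  then have fV: "f v \<in> V" for v using X by blast
  have f_le: "key v (f v) \<le> key v y" if "y \<in> X" for v y
    unfolding f_def using arg_min_least[OF finX X(2) that] .
  have near: "d (f v) v \<le> d y v" if "y \<in> X" for v y
  proof -
    have "n * d (f v) v < n * (d y v + 1)"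
      using f_le[OF that, of v] i_less[OF that] unfolding key_def by simp
    then have "d (f v) v < d y v + 1" using mult_less_cancel1 by metis
    then show ?thesis by simp
  qed
  have path: "(v, x) \<in> (Restr E {u \<in> V. f u = x})\<^sup>*" if "v \<in> V" "f v = x" for v x
    using that
  proof (induction "d x v" arbitrary: v)
    case 0
    then have "x = v" using dist_eq_0[of x v] fV[of v] by simp
    then show ?case by simp
  next
    case (Suc m)
    have xV: "x \<in> V" using fV[of v] Suc.prems by simp
    obtain u where u: "u \<in> V" "(u, v) \<in> E" "d x u = m"
      using dist_pred[OF xV Suc.prems(1)] Suc.hyps(2) by metis
    \<comment> \<open>From \<open>u\<close> to \<open>v\<close> the key of any centre grows by at
      most \<open>n\<close>, that of \<open>x\<close> by exactly \<open>n\<close>. So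
      \<open>f u\<close> ties with \<open>x\<close> at \<open>v\<close>, and the residues modulo
      \<open>n\<close>, which are the values of \<open>i\<close>, agree.\<close>
    have "key v (f u) \<le> key u (f u) + n"
      using dist_step[OF fV[of u] u(2)] mult_le_mono2[of _ _ n] unfolding key_def
      by (metis add.commute add_le_cancel_left distrib_left group_cancel.add2 mult.right_neutral)
    also have "key u (f u) + n \<le> key u x + n" using f_le fX[of v] Suc.prems by simp
    also have "\<dots> = key v x" unfolding key_def u(3) Suc.hyps(2)[symmetric] by simp
    finally have "key v (f u) = key v x" using f_le[OF fX[of u], of v] Suc.prems(2) by simp
    then have "key v (f u) mod n = key v x mod n" by simp
    then have "i (f u) = i x" using i_less fX[of u] fX[of v] Suc.prems(2) unfolding key_def by simp
    then have "f u = x" using i(2) fV[of u] xV by (simp add: inj_on_eq_iff)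
    then show ?case
      using Suc.hyps(1)[of u] u Suc.prems E_commute[of u v]
      by (intro converse_rtrancl_into_rtrancl[of v u]) auto
  qed
  show ?thesis using fX near path by (intro exI[of _ f]) auto
qed

lemma maximal_separated_set:
  assumes "finite Q" "Q \<subseteq> V"
  obtains X where "X \<subseteq> Q" "\<And>x y. x \<in> X \<Longrightarrow> y \<in> X \<Longrightarrow> x \<noteq> y \<Longrightarrow> k < d x y"
    "\<And>q. q \<in> Q \<Longrightarrow> \<exists>x\<in>X. d x q \<le> k"
proof -
  define S where "S = {X \<in> Pow Q. \<forall>x\<in>X. \<forall>y\<in>X. x \<noteq> y \<longrightarrow> k < d x y}"
  have "finite S" "{} \<in> S" using assms unfolding S_def by auto
  then obtain X where X: "X \<in> S" and max: "\<And>Y. Y \<in> S \<Longrightarrow> X \<subseteq> Y \<Longrightarrow> X = Y"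
    using finite_has_maximal2[of S "{}"] by metis
  have "\<exists>x\<in>X. d x q \<le> k" if q: "q \<in> Q" for q
  proof (rule ccontr)
    assume *: "\<not> ?thesis"
    have far: "k < d x q" "k < d q x" if x: "x \<in> X" for x
    proof -
      have "x \<in> V" "q \<in> V" using x X q assms(2) unfolding S_def by auto
      then show "k < d x q" "k < d q x" using * x dist_commute[of x q] by (auto simp: not_le)
    qed
    then have "insert q X \<in> S" using X q unfolding S_def by auto
    then have "q \<in> X" using max by blast
    then show False using * by force
  qed
  then show ?thesis using X that unfolding S_def by blast
qed

text \<open>Separation by more than \<open>2 * k\<close> keeps the \<open>k\<close>-ball of a centre
  inside its cell, and maximality bounds the radius of the cells by \<open>2 * k + 1\<close>. Any
  cell adjacent to that of \<open>x\<close> then lies in the shell in which the branches at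
  \<open>x\<close> are separated, so different branches reach different cells.\<close>

lemma branching_dense_family:
  assumes Q: "Q \<subseteq> V" "\<And>w. w \<in> Q \<Longrightarrow> branching G w N k (6 * k + 4)"
    and near: "\<And>v. v \<in> V \<Longrightarrow> \<exists>w\<in>Q. w = v \<or> (v, w) \<in> E"
  shows "\<exists>F. branch_family E F \<and> F \<noteq> {} \<and> \<Union>F \<subseteq> V \<and> N * card F \<le> card (touching_pairs E F)"
proof -
  have finQ: "finite Q" using Q finite_verts finite_subset by blast
  obtain X where XQ: "X \<subseteq> Q" and sep: "\<And>x y. x \<in> X \<Longrightarrow> y \<in> X \<Longrightarrow> x \<noteq> y \<Longrightarrow> 2 * k < d x y"
    and dom: "\<And>q. q \<in> Q \<Longrightarrow> \<exists>x\<in>X. d x q \<le> 2 * k"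
    using maximal_separated_set[OF finQ Q(1)] by metis
  have XV: "X \<subseteq> V" and finX: "finite X" using XQ Q finQ finite_subset by auto
  obtain v0 where "v0 \<in> V" using connected unfolding connected_graph_def by blast
  then have Xne: "X \<noteq> {}" using near dom by blast
  obtain f where "\<forall>v\<in>V. f v \<in> X \<and> (\<forall>y\<in>X. d (f v) v \<le> d y v) \<and>
      (v, f v) \<in> (Restr E {u \<in> V. f u = f v})\<^sup>*"
    using voronoi_cells[OF XV Xne] by (rule exE)
  then have f: "\<And>v. v \<in> V \<Longrightarrow> f v \<in> X" "\<And>v y. v \<in> V \<Longrightarrow> y \<in> X \<Longrightarrow> d (f v) v \<le> d y v"
    "\<And>v. v \<in> V \<Longrightarrow> (v, f v) \<in> (Restr E {u \<in> V. f u = f v})\<^sup>*"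
    by simp_all
  define U where "U x = {v \<in> V. f v = x}" for x
  have radius: "d (f v) v \<le> 2 * k + 1" if v: "v \<in> V" for v
  proof -
    obtain w where w: "w \<in> Q" "w = v \<or> (v, w) \<in> E" using near[OF v] by blast
    obtain x where x: "x \<in> X" "d x w \<le> 2 * k" using dom w by blast
    have "d x v \<le> 2 * k + 1"
      using w(2) x dist_step[of x w v] XV E_commute[of v w] by auto
    then show ?thesis using f(2)[OF v x(1)] by simp
  qed
  have ball: "f v = x" if "x \<in> X" "v \<in> V" "d x v \<le> k" for x v
  proof (rule ccontr)
    assume "f v \<noteq> x"
    then have "2 * k < d x (f v)" using sep f(1) that by metis
    moreover have "d x (f v) \<le> d x v + d (f v) v"
      using dist_triangle[of x v "f v"] dist_commute[of v "f v"] that f(1)[OF that(2)] XV by auto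
    moreover have "d (f v) v \<le> d x v" using f(2) that by blast
    ultimately show False using that(3) by simp
  qed
  have U_path: "(u, v) \<in> (Restr E (U x))\<^sup>*" if "u \<in> U x" "v \<in> U x" for u v x
  proof -
    have "(w, x) \<in> (Restr E (U x))\<^sup>*" if "w \<in> U x" for w
      using f(3)[of w] that unfolding U_def by blast
    then have "(u, x) \<in> (Restr E (U x))\<^sup>*" "(v, x) \<in> (Restr E (U x))\<^sup>*" using that by blast+
    then show ?thesis using path_commute by (meson rtrancl_trans)
  qed
  have xU: "x \<in> U x" if "x \<in> X" for x
    using ball[OF that, of x] that XV unfolding U_def by fastforce
  have U_disj: "U x \<inter> U y = {}" if "x \<noteq> y" for x y using that unfolding U_def by auto
  have bf: "branch_family E (U ` X)"
    unfolding branch_family_def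
  proof (intro conjI ballI)
    show "connected_in E Y" if "Y \<in> U ` X" for Y
      using that xU U_path unfolding connected_in_def by blast
    show "disjoint (U ` X)"
      using U_disj by (intro disjointI) (metis imageE)
  qed (use finX in simp)
  define nbrs where "nbrs Y = {Z \<in> U ` X. Y \<noteq> Z \<and> touch E Y Z}" for Y
  have many: "N \<le> card (nbrs (U x))" if x: "x \<in> X" for x
  proof -
    have xV: "x \<in> V" using x XV by blast
    let ?W = "shell G x k (6 * k + 4)"
    obtain A where A: "finite A" "card A = N" "A \<subseteq> {v \<in> V. d x v = 6 * k + 4}"
      and Asep: "\<And>a b. a \<in> A \<Longrightarrow> b \<in> A \<Longrightarrow> a \<noteq> b \<Longrightarrow> (a, b) \<notin> (Restr E ?W)\<^sup>*"
      using Q(2)[of x] x XQ unfolding branching_def by blast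
    have "\<exists>t s. f s = x \<and> f t \<noteq> x \<and> (s, t) \<in> E \<and> (t, a) \<in> (Restr E ?W)\<^sup>*" if a: "a \<in> A" for a
    proof -
      have aV: "a \<in> V" "d x a = 6 * k + 4" using A a by auto
      have fa: "f a \<noteq> x" using radius[OF aV(1)] aV(2) by auto
      obtain p where p: "p \<in> V" "d x p = Suc k"
        "(p, a) \<in> (Restr E {v \<in> V. Suc k \<le> d x v \<and> d x v \<le> d x a})\<^sup>*"
        using geodesic[OF xV aV(1), of "Suc k"] aV by auto
      have pa: "(p, a) \<in> (Restr E ?W)\<^sup>*"
        by (rule Restr_rtrancl_mono[OF p(3)]) (auto simp: shell_def aV)
      show ?thesis
      proof (cases "f p = x")
        case True
        then show ?thesis using path_exit[OF pa, of "\<lambda>v. f v = x"] fa by blast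
      next
        case False
        \<comment> \<open>Here \<open>p\<close> is already outside the cell of \<open>x\<close>,
          while its predecessor at distance \<open>k\<close> is inside; take \<open>t\<close> to be
          \<open>p\<close>.\<close>
        obtain s where "s \<in> V" "(s, p) \<in> E" "d x s = k" using dist_pred[OF xV p(1,2)] by metis
        then show ?thesis using False pa ball[OF x] by (metis order.refl)
      qed
    qed
    then obtain t s where ts: "\<And>a. a \<in> A \<Longrightarrow> f (s a) = x" "\<And>a. a \<in> A \<Longrightarrow> f (t a) \<noteq> x"
      "\<And>a. a \<in> A \<Longrightarrow> (s a, t a) \<in> E" "\<And>a. a \<in> A \<Longrightarrow> (t a, a) \<in> (Restr E ?W)\<^sup>*"
      by metis
    have V: "s a \<in> V" "t a \<in> V" if "a \<in> A" for a using adjD[OF simple ts(3)[OF that]] by auto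
    \<comment> \<open>Origin of \<open>6 * k + 4\<close>: at most \<open>2 * k + 2\<close> from
      \<open>x\<close> to \<open>t a\<close>, then \<open>2 * k + 1\<close> to the centre of that
      cell and \<open>2 * k + 1\<close> to any of its vertices. The \<open>k\<close>-ball of
      \<open>x\<close> is avoided because it belongs to the cell of \<open>x\<close>.\<close>
    have cell_W: "U (f (t a)) \<subseteq> ?W" if a: "a \<in> A" for a
    proof
      fix z assume "z \<in> U (f (t a))"
      then have z: "z \<in> V" "f z = f (t a)" unfolding U_def by auto
      let ?y = "f (t a)"
      have yV: "?y \<in> V" using f(1)[OF V(2)[OF a]] XV by blast
      have "d x (t a) \<le> 2 * k + 2"
        using radius[OF V(1)[OF a]] ts(1)[OF a] dist_step[OF xV ts(3)[OF a]] by simp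
      moreover have "d (t a) ?y \<le> 2 * k + 1"
        using radius[OF V(2)[OF a]] dist_commute[OF yV V(2)[OF a]] by simp
      ultimately have "d x ?y \<le> 4 * k + 3" using dist_triangle[OF xV V(2)[OF a] yV] by simp
      moreover have "d ?y z \<le> 2 * k + 1" using radius[OF z(1)] z(2) by simp
      ultimately have "d x z \<le> 6 * k + 4" using dist_triangle[OF xV yV z(1)] by simp
      moreover have "\<not> d x z \<le> k" using ball[OF x z(1)] z(2) ts(2)[OF a] by auto
      ultimately show "z \<in> ?W" using z(1) unfolding shell_def by simp
    qed
    have inj: "inj_on (\<lambda>a. U (f (t a))) A"
    proof (rule inj_onI, rule ccontr)
      fix a b assume ab: "a \<in> A" "b \<in> A" "U (f (t a)) = U (f (t b))" "a \<noteq> b"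
      have "t a \<in> U (f (t a))" "t b \<in> U (f (t a))"
        using V(2)[OF ab(1)] V(2)[OF ab(2)] ab(3) unfolding U_def by blast+
      then have "(t a, t b) \<in> (Restr E ?W)\<^sup>*"
        using Restr_rtrancl_mono[OF U_path cell_W[OF ab(1)]] by simp
      moreover have "(a, t a) \<in> (Restr E ?W)\<^sup>*" using ts(4)[OF ab(1)] path_commute by metis
      ultimately have "(a, b) \<in> (Restr E ?W)\<^sup>*" using ts(4)[OF ab(2)] by (meson rtrancl_trans)
      then show False using Asep ab by blast
    qed
    have "(\<lambda>a. U (f (t a))) ` A \<subseteq> nbrs (U x)"
    proof (rule image_subsetI)
      fix a assume a: "a \<in> A"
      have "s a \<in> U x" "t a \<in> U (f (t a))" "t a \<notin> U x" "f (t a) \<in> X"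
        using V[OF a] ts(1,2)[OF a] f(1) unfolding U_def by auto
      then show "U (f (t a)) \<in> nbrs (U x)"
        using ts(3)[OF a] unfolding nbrs_def touch_def by blast
    qed
    then have "card A \<le> card (nbrs (U x))"
      using inj finX by (intro card_inj_on_le) (auto simp: nbrs_def)
    then show ?thesis using A by simp
  qed
  have "touching_pairs E (U ` X) = (SIGMA Y:U ` X. nbrs Y)"
    unfolding touching_pairs_def nbrs_def by auto
  then have "card (touching_pairs E (U ` X)) = (\<Sum>Y\<in>U ` X. card (nbrs Y))"
    using finX by (simp add: nbrs_def)
  moreover have "(\<Sum>Y\<in>U ` X. N) \<le> (\<Sum>Y\<in>U ` X. card (nbrs Y))"
    using many by (intro sum_mono) blast
  ultimately have "N * card (U ` X) \<le> card (touching_pairs E (U ` X))"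
    by (simp add: mult.commute)
  then show ?thesis using bf Xne unfolding U_def by (intro exI[of _ "U ` X"]) (auto simp: U_def)
qed

end

section \<open>Clique minors and automorphisms\<close>

lemma adj_induced: "adj (induced_subgraph G W) = Restr (adj G) W"
  unfolding adj_def induced_subgraph_def by auto

text \<open>One vertex chosen from each branch set. The bound ensures that \<open>GREATEST\<close>
  in \<open>Had\<close> denotes a true maximum.\<close>

lemma minor_complete_le_card:
  assumes "finite (verts G)" "is_minor (complete_graph h) G"
  shows "h \<le> card (verts G)"
proof -
  obtain B where B: "\<And>v. v < h \<Longrightarrow> B v \<subseteq> verts G \<and> connected_graph (induced_subgraph G (B v))"
    "\<And>u v. u < h \<Longrightarrow> v < h \<Longrightarrow> u \<noteq> v \<Longrightarrow> B u \<inter> B v = {}"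
  proof -
    obtain B where B: "\<forall>v\<in>{..<h}. B v \<subseteq> verts G \<and> connected_graph (induced_subgraph G (B v))"
      "\<forall>u\<in>{..<h}. \<forall>v\<in>{..<h}. u \<noteq> v \<longrightarrow> B u \<inter> B v = {}"
      using assms(2) unfolding is_minor_def complete_graph_def graph.simps by (elim exE conjE)
    show ?thesis by (rule that[of B]) (use B in simp_all)
  qed
  have "\<exists>x. x \<in> B v" if "v < h" for v
    using B(1)[OF that] unfolding connected_graph_def induced_subgraph_def by auto
  then obtain x where x: "\<And>v. v < h \<Longrightarrow> x v \<in> B v" by metis
  have "inj_on x {..<h}" using x B(2) by (intro inj_onI) (metis IntI empty_iff lessThan_iff)
  moreover have "x ` {..<h} \<subseteq> verts G" using x B(1) by blast
  ultimately show ?thesis using card_inj_on_le[OF _ _ assms(1)] by fastforce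
qed

lemma Had_ge_card_clique:
  assumes "finite (verts G)" and K: "branch_family (adj G) K" "\<Union>K \<subseteq> verts G"
    and touch: "\<And>A B. A \<in> K \<Longrightarrow> B \<in> K \<Longrightarrow> A \<noteq> B \<Longrightarrow> touch (adj G) A B"
  shows "card K \<le> Had G"
proof -
  have "finite K" using K(1) unfolding branch_family_def by simp
  then obtain B where B: "bij_betw B {..<card K} K"
    using ex_bij_betw_nat_finite atLeast0LessThan by metis
  have BK: "B i \<in> K" if "i < card K" for i using B that bij_betwE by blast
  have BB: "B i \<noteq> B j" if "i < card K" "j < card K" "i \<noteq> j" for i j
    using B that inj_onD[of B "{..<card K}" i j] unfolding bij_betw_def by auto
  have "is_minor (complete_graph (card K)) G"
    unfolding is_minor_def
  proof (intro exI[of _ B] conjI ballI impI allI)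
    fix i assume "i \<in> verts (complete_graph (card K))"
    then have i: "B i \<in> K" using BK unfolding complete_graph_def by simp
    then show sub: "B i \<subseteq> verts G" using K(2) by blast
    have "connected_in (adj G) (B i)" using K(1) i unfolding branch_family_def by blast
    moreover have "verts (induced_subgraph G (B i)) = B i"
      using sub unfolding induced_subgraph_def by auto
    ultimately show "connected_graph (induced_subgraph G (B i))"
      unfolding connected_graph_def connected_in_def by (simp add: adj_induced)
  next
    fix i j assume "i \<in> verts (complete_graph (card K))" "j \<in> verts (complete_graph (card K))" "i \<noteq> j"
    then show "B i \<inter> B j = {}"
      using disjointD[of K "B i" "B j"] BK BB K(1) unfolding complete_graph_def branch_family_def by simp
  next
    fix i j assume "{i, j} \<in> edges (complete_graph (card K))"
    then have "i < card K" "j < card K" "i \<noteq> j"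
      unfolding complete_graph_def by (auto simp: card_2_iff doubleton_eq_iff)
    then have "touch (adj G) (B i) (B j)" by (intro touch BK BB)
    then show "\<exists>x\<in>B i. \<exists>y\<in>B j. {x, y} \<in> edges G"
      unfolding touch_def adj_def by simp
  qed
  then show ?thesis
    unfolding Had_def using minor_complete_le_card[OF assms(1)] by (rule Greatest_le_nat)
qed

context finite_connected_graph
begin

lemma Had_ge_of_branching:
  assumes "Q \<subseteq> V" "\<And>w. w \<in> Q \<Longrightarrow> branching G w N k (6 * k + 4)"
    and "\<And>v. v \<in> V \<Longrightarrow> \<exists>w\<in>Q. w = v \<or> (v, w) \<in> E"
    and "2 ^ Suc h \<le> N"
  shows "h \<le> Had G"
proof -
  obtain F where F: "branch_family E F" "F \<noteq> {}" "\<Union>F \<subseteq> V"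
    "N * card F \<le> card (touching_pairs E F)"
    using branching_dense_family[OF assms(1-3)] by blast
  have "2 ^ Suc h * card F \<le> N * card F" using assms(4) by (rule mult_le_mono1)
  then have "2 ^ Suc h * card F \<le> card (touching_pairs E F)" using F(4) by (rule order.trans)
  from dense_family_clique[OF adj_sym F(1,2) this] obtain K where
    K: "branch_family E K" "card K = h" "\<forall>A\<in>K. \<forall>B\<in>K. A \<noteq> B \<longrightarrow> touch E A B"
    "\<forall>B\<in>K. B \<subseteq> \<Union>F \<and> (\<exists>A\<in>F. A \<subseteq> B)" by (elim exE conjE)
  have "\<Union>K \<subseteq> V" using K(4) F(3) by (meson Sup_least order.trans)
  then have "card K \<le> Had G"
    by (intro Had_ge_card_clique[OF finite_verts K(1)]) (use K(3) in auto)
  then show ?thesis using K(2) by simp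
qed

section \<open>Automorphisms and the transport of branching to translates\<close>

lemma automorphism_inv:
  assumes f: "automorphism G f"
  shows "automorphism G (inv_into V f)"
proof -
  have bij: "bij_betw f V V" using f unfolding automorphism_def by blast
  then have "bij_betw (inv_into V f) V V" by (rule bij_betw_inv_into)
  moreover have "{inv_into V f u, inv_into V f v} \<in> edges G \<longleftrightarrow> {u, v} \<in> edges G"
    if "u \<in> V" "v \<in> V" for u v
  proof -
    have "inv_into V f u \<in> V" "inv_into V f v \<in> V"
      using \<open>bij_betw (inv_into V f) V V\<close> that bij_betwE by blast+
    moreover have "f (inv_into V f u) = u" "f (inv_into V f v) = v"
      using bij that by (simp_all add: bij_betw_inv_into_right)
    ultimately show ?thesis using f unfolding automorphism_def by metis
  qed
  ultimately show ?thesis unfolding automorphism_def by blast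
qed

lemma automorphism_in: "automorphism G f \<Longrightarrow> v \<in> V \<Longrightarrow> f v \<in> V"
  unfolding automorphism_def using bij_betwE by blast

lemma automorphism_adj: "automorphism G f \<Longrightarrow> (u, v) \<in> E \<Longrightarrow> (f u, f v) \<in> E"
  using adjD[OF simple, of u v] unfolding automorphism_def adj_def by blast

lemma automorphism_dist_le:
  assumes "automorphism G f" "u \<in> V" "v \<in> V"
  shows "d (f u) (f v) \<le> d u v"
proof (rule dist_le)
  have "(f u, f v) \<in> E ^^ n" if "(u, v) \<in> E ^^ n" for n v
    using that by (induction n arbitrary: v) (auto dest: automorphism_adj[OF assms(1)])
  then show "(f u, f v) \<in> E ^^ d u v" using dist_path assms by blast
qed

lemma inv_automorphism_cancel: "automorphism G f \<Longrightarrow> v \<in> V \<Longrightarrow> inv_into V f (f v) = v"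
  unfolding automorphism_def by (auto intro: bij_betw_inv_into_left)

lemma automorphism_dist:
  assumes "automorphism G f" "u \<in> V" "v \<in> V"
  shows "d (f u) (f v) = d u v"
  using automorphism_dist_le[OF assms] inv_automorphism_cancel[OF assms(1)] assms
    automorphism_dist_le[OF automorphism_inv[OF assms(1)], of "f u" "f v"]
    automorphism_in[OF assms(1)] by simp

lemma automorphism_path:
  assumes f: "automorphism G f" and c: "c \<in> V"
    and "(u, v) \<in> (Restr E (shell G c k R))\<^sup>*"
  shows "(f u, f v) \<in> (Restr E (shell G (f c) k R))\<^sup>*"
  using assms(3)
proof (induction rule: rtrancl_induct)
  case (step y z)
  have "(f y, f z) \<in> Restr E (shell G (f c) k R)"
    using step.hyps(2) automorphism_adj[OF f] automorphism_in[OF f] automorphism_dist[OF f c]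
    unfolding shell_def by auto
  then show ?case using step.IH by (rule rtrancl_into_rtrancl[rotated])
qed simp

lemma branching_automorphism:
  assumes f: "automorphism G f" and c: "c \<in> V" and "branching G c N k R"
  shows "branching G (f c) N k R"
proof -
  obtain A where A: "finite A" "card A = N" "A \<subseteq> {v \<in> V. d c v = R}"
    and Asep: "\<And>a b. a \<in> A \<Longrightarrow> b \<in> A \<Longrightarrow> a \<noteq> b \<Longrightarrow> (a, b) \<notin> (Restr E (shell G c k R))\<^sup>*"
    using assms(3) unfolding branching_def by blast
  let ?g = "inv_into V f"
  have g: "?g (f v) = v" if "v \<in> V" for v using inv_automorphism_cancel[OF f that] .
  have AV: "A \<subseteq> V" using A by blast
  show ?thesis
    unfolding branching_def
  proof (intro exI[of _ "f ` A"] conjI ballI impI)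
    have "inj_on f A"
      using f inj_on_subset[OF _ AV] unfolding automorphism_def bij_betw_def by blast
    then show "card (f ` A) = N" using A by (simp add: card_image)
    show "f ` A \<subseteq> {v \<in> V. d (f c) v = R}"
      using A automorphism_in[OF f] automorphism_dist[OF f c] by auto
    fix x y assume "x \<in> f ` A" "y \<in> f ` A" "x \<noteq> y"
    then obtain a b where ab: "x = f a" "y = f b" "a \<in> A" "b \<in> A" "a \<noteq> b" by blast
    show "(x, y) \<notin> (Restr E (shell G (f c) k R))\<^sup>*"
    proof
      assume "(x, y) \<in> (Restr E (shell G (f c) k R))\<^sup>*"
      from automorphism_path[OF automorphism_inv[OF f] automorphism_in[OF f c] this]
      have "(a, b) \<in> (Restr E (shell G c k R))\<^sup>*"
        using ab AV c g by (simp add: subset_iff)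
      then show False using Asep ab by blast
    qed
  qed (use A in simp)
qed

text \<open>Map an edge at \<open>c\<close> to an edge at \<open>v\<close>: the image of
  \<open>c\<close> is \<open>v\<close> or the other endpoint. The identity handles
  \<open>v = c\<close>, where there may be no edge at all.\<close>

lemma edge_transitive_orbit_near:
  assumes "edge_transitive G" "c \<in> V" "v \<in> V"
  shows "\<exists>w\<in>{f c |f. automorphism G f}. w = v \<or> (v, w) \<in> E"
proof (cases "v = c")
  case True
  have "automorphism G id" unfolding automorphism_def by simp
  then show ?thesis using True by force
next
  case False
  have nbr: "\<exists>u. (u, y) \<in> E" if xy: "x \<in> V" "y \<in> V" "x \<noteq> y" for x y
  proof -
    obtain n where "d x y = Suc n" using dist_eq_0[OF xy(1,2)] xy(3) by (cases "d x y") auto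
    then show ?thesis using dist_pred[OF xy(1,2)] by metis
  qed
  obtain u u' where "(u, c) \<in> E" "(u', v) \<in> E"
    using nbr[of v c] nbr[of c v] assms False by blast
  then have "{u, c} \<in> edges G" "{u', v} \<in> edges G" "(v, u') \<in> E"
    using E_commute unfolding adj_def by auto
  moreover from this obtain f where "automorphism G f" "f ` {u, c} = {u', v}"
    using assms(1) unfolding edge_transitive_def by blast
  moreover from this have "f c = u' \<or> f c = v" by blast
  ultimately show ?thesis by blast
qed

end

section \<open>Rays and BFS labels\<close>

lemma delete_verts_simps:
  "verts (delete_verts G S) = verts G - S" "adj (delete_verts G S) = Restr (adj G) (verts G - S)"
  unfolding delete_verts_def adj_induced by (auto simp: induced_subgraph_def)

lemma components_disjoint:
  assumes "C \<in> components G" "D \<in> components G" "C \<inter> D \<noteq> {}"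
  shows "C = D"
proof -
  have eq: "equiv (verts G) {(u, v). u \<in> verts G \<and> v \<in> verts G \<and> (u, v) \<in> (adj G)\<^sup>*}"
  proof (intro equivI)
    show "sym {(u, v). u \<in> verts G \<and> v \<in> verts G \<and> (u, v) \<in> (adj G)\<^sup>*}"
      using symD[OF sym_rtrancl[OF adj_sym[of G]]] unfolding sym_def by simp
    show "trans {(u, v). u \<in> verts G \<and> v \<in> verts G \<and> (u, v) \<in> (adj G)\<^sup>*}"
      unfolding trans_def by (auto intro: rtrancl_trans)
  qed (auto simp: refl_on_def)
  show ?thesis
    using quotient_disj[OF eq assms(1,2)[unfolded components_def]] assms(3) by simp
qed

lemma sym_ray_equiv: "sym (ray_equiv G)"
  unfolding ray_equiv_def sym_def by auto

text \<open>Two components that both contain almost all of the infinite set \<open>range s\<close>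
  intersect, hence coincide.\<close>

lemma trans_ray_equiv: "trans (ray_equiv G)"
proof (rule transI)
  fix r s t assume rs: "(r, s) \<in> ray_equiv G" and st: "(s, t) \<in> ray_equiv G"
  show "(r, t) \<in> ray_equiv G"
    unfolding ray_equiv_def
  proof (intro CollectI case_prodI conjI allI impI)
    fix S assume S: "finite S \<and> S \<subseteq> verts G"
    obtain C where C: "C \<in> components (delete_verts G S)" "finite (range r - C)" "finite (range s - C)"
      using rs S unfolding ray_equiv_def by blast
    obtain D where D: "D \<in> components (delete_verts G S)" "finite (range s - D)" "finite (range t - D)"
      using st S unfolding ray_equiv_def by blast
    have "inj s" using rs unfolding ray_equiv_def rays_def by blast
    then have "infinite (range s)" by (metis finite_imageD infinite_UNIV_nat)
    moreover have "range s \<subseteq> (range s - C) \<union> (range s - D) \<union> (C \<inter> D)" by blast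
    ultimately have "C \<inter> D \<noteq> {}" using C(3) D(2) by (metis finite_Un finite_subset sup_bot_right)
    then have "C = D" using components_disjoint C(1) D(1) by blast
    then show "\<exists>C\<in>components (delete_verts G S). finite (range r - C) \<and> finite (range t - C)"
      using C D by blast
  qed (use rs st in \<open>auto simp: ray_equiv_def\<close>)
qed

text \<open>Infinitely many ends form a separate case because \<open>card\<close> of an infinite set
  is 0.\<close>

lemma inequivalent_rays:
  assumes "infinite (ends G) \<or> N \<le> card (ends G)"
  obtains T where "finite T" "card T = N" "T \<subseteq> rays G"
    "\<forall>r\<in>T. \<forall>s\<in>T. r \<noteq> s \<longrightarrow> (r, s) \<notin> ray_equiv G"
proof -
  obtain X where X: "X \<subseteq> ends G" "finite X" "card X = N"
    using assms infinite_arbitrarily_large obtain_subset_with_card_n by metis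
  have "\<exists>r\<in>rays G. x = ray_equiv G `` {r}" if "x \<in> X" for x
    using that X(1) unfolding ends_def quotient_def by blast
  then obtain rep where rep: "\<And>x. x \<in> X \<Longrightarrow> rep x \<in> rays G"
    "\<And>x. x \<in> X \<Longrightarrow> x = ray_equiv G `` {rep x}" by metis
  have "inj_on rep X" using rep(2) by (metis inj_onI)
  then have "card (rep ` X) = N" using X by (simp add: card_image)
  moreover have "(rep x, rep y) \<notin> ray_equiv G" if "x \<in> X" "y \<in> X" "rep x \<noteq> rep y" for x y
  proof
    assume *: "(rep x, rep y) \<in> ray_equiv G"
    then have "ray_equiv G `` {rep x} = ray_equiv G `` {rep y}"
      using sym_ray_equiv trans_ray_equiv by (blast dest: symD transD)
    then show False using rep(2) that by metis
  qed
  ultimately show ?thesis using X(2) rep(1) that[of "rep ` X"] by auto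
qed

lemma ray_path:
  assumes "r \<in> rays G" "p \<le> q" "\<And>i. p \<le> i \<Longrightarrow> r i \<in> W"
  shows "(r p, r q) \<in> (Restr (adj G) W)\<^sup>*"
  using assms(2)
proof (induction q rule: dec_induct)
  case (step n)
  have "(r n, r (Suc n)) \<in> Restr (adj G) W"
    using assms(1,3) step.hyps unfolding rays_def adj_def by simp
  then show ?case using step.IH by (rule rtrancl_into_rtrancl[rotated])
qed simp

text \<open>A single path between the tails would put both of them into one component, with only the
  first \<open>p\<close> vertices of each ray possibly outside.\<close>

lemma ray_tails_inequivalent:
  assumes rays: "r \<in> rays G" "s \<in> rays G" and S: "finite S" "S \<subseteq> verts G"
    and no_comp: "\<not> (\<exists>C\<in>components (delete_verts G S). finite (range r - C) \<and> finite (range s - C))"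
    and p: "\<And>i. p \<le> i \<Longrightarrow> r i \<notin> S" "\<And>i. p \<le> i \<Longrightarrow> s i \<notin> S"
    and q: "p \<le> q" "p \<le> q'"
  shows "(r q, s q') \<notin> (Restr (adj G) (verts G - S))\<^sup>*"
proof
  let ?W = "verts G - S"
  assume path: "(r q, s q') \<in> (Restr (adj G) ?W)\<^sup>*"
  have W: "r i \<in> ?W" "s i \<in> ?W" if "p \<le> i" for i
    using rays p that unfolding rays_def by auto
  have comm: "(u, v) \<in> (Restr (adj G) ?W)\<^sup>* \<Longrightarrow> (v, u) \<in> (Restr (adj G) ?W)\<^sup>*" for u v
    by (rule Restr_rtrancl_sym[OF adj_sym])
  define C where "C = {v \<in> ?W. (r p, v) \<in> (Restr (adj G) ?W)\<^sup>*}"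
  have C_eq: "C = {(u, v). u \<in> ?W \<and> v \<in> ?W \<and> (u, v) \<in> (Restr (adj G) ?W)\<^sup>*} `` {r p}"
    using W(1) unfolding C_def by auto
  have comp: "C \<in> components (delete_verts G S)"
    unfolding components_def delete_verts_simps C_eq by (rule quotientI[OF W(1)[OF order.refl]])
  have rC: "r i \<in> C" if "p \<le> i" for i
    using ray_path[OF rays(1) that W(1)] W(1)[OF that] unfolding C_def by simp
  have "(r p, s p) \<in> (Restr (adj G) ?W)\<^sup>*"
    using ray_path[OF rays(1) q(1) W(1)] path comm[OF ray_path[OF rays(2) q(2) W(2)]]
    by (meson rtrancl_trans)
  then have sC: "s i \<in> C" if "p \<le> i" for i
    using ray_path[OF rays(2) that W(2)] W(2)[OF that] unfolding C_def by (auto intro: rtrancl_trans)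
  have "range r - C \<subseteq> r ` {..<p}" "range s - C \<subseteq> s ` {..<p}"
    using rC sC by (auto simp: not_less[symmetric])
  then have "finite (range r - C)" "finite (range s - C)"
    by (meson finite_imageI finite_lessThan finite_subset)+
  then show False using no_comp comp by blast
qed

text \<open>The union of separators for all pairs works, since deleting more vertices creates no new
  paths. Rays are injective and meet it finitely often, which gives a common
  \<open>p\<close>.\<close>

lemma finite_ray_separator:
  assumes T: "finite T" "T \<subseteq> rays G"
    and ineq: "\<forall>r\<in>T. \<forall>s\<in>T. r \<noteq> s \<longrightarrow> (r, s) \<notin> ray_equiv G"
  shows "\<exists>S p. finite S \<and> S \<subseteq> verts G \<and> (\<forall>r\<in>T. \<forall>s\<in>T. r \<noteq> s \<longrightarrow>
    (\<forall>q\<ge>p. \<forall>q'\<ge>p. (r q, s q') \<notin> (Restr (adj G) (verts G - S))\<^sup>*))"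
proof -
  have "\<exists>S. finite S \<and> S \<subseteq> verts G \<and> (r \<noteq> s \<longrightarrow>
      \<not> (\<exists>C\<in>components (delete_verts G S). finite (range r - C) \<and> finite (range s - C)))"
    if "r \<in> T" "s \<in> T" for r s
  proof (cases "r = s")
    case False
    then have "(r, s) \<notin> ray_equiv G" using ineq that by blast
    then show ?thesis using that T(2) unfolding ray_equiv_def by blast
  qed (intro exI[of _ "{}"]; simp)
  then obtain sep where sep: "\<And>r s. r \<in> T \<Longrightarrow> s \<in> T \<Longrightarrow> finite (sep r s) \<and> sep r s \<subseteq> verts G"
    "\<And>r s. r \<in> T \<Longrightarrow> s \<in> T \<Longrightarrow> r \<noteq> s \<Longrightarrow> \<not> (\<exists>C\<in>components (delete_verts G (sep r s)).
      finite (range r - C) \<and> finite (range s - C))" by metis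
  define S where "S = (\<Union>r\<in>T. \<Union>s\<in>T. sep r s)"
  have S: "finite S" "S \<subseteq> verts G" using sep(1) T(1) unfolding S_def by auto
  have "finite (\<Union>r\<in>T. r -` S)"
    using T S(1) unfolding rays_def by (auto intro!: finite_vimageI)
  then obtain p where p: "\<And>i. i \<in> (\<Union>r\<in>T. r -` S) \<Longrightarrow> i < p"
    using finite_nat_set_iff_bounded by metis
  have tail: "r i \<notin> S" if "r \<in> T" "p \<le> i" for r i
    using p[of i] that by auto
  have "(r q, s q') \<notin> (Restr (adj G) (verts G - S))\<^sup>*"
    if rs: "r \<in> T" "s \<in> T" "r \<noteq> s" and q: "p \<le> q" "p \<le> q'" for r s q q'
  proof
    assume path: "(r q, s q') \<in> (Restr (adj G) (verts G - S))\<^sup>*"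
    have sub: "sep r s \<subseteq> S" using rs unfolding S_def by blast
    then have "(r q, s q') \<in> (Restr (adj G) (verts G - sep r s))\<^sup>*"
      by (intro Restr_rtrancl_mono[OF path]) blast
    moreover have "(r q, s q') \<notin> (Restr (adj G) (verts G - sep r s))\<^sup>*"
      by (rule ray_tails_inequivalent[where p = p]) (use rs q T(2) sep tail sub in blast)+
    ultimately show False by blast
  qed
  then show ?thesis using S by (intro exI[of _ S] exI[of _ p]) simp
qed

section \<open>Distances versus labels in BFS-labeled graphs\<close>

locale BFS_graph = finite_connected_graph G for G :: "nat graph" +
  assumes BFS: "BFS_labeled G"
begin

lemma verts_interval: "1 \<in> V" "v \<in> V \<Longrightarrow> 1 \<le> i \<Longrightarrow> i \<le> v \<Longrightarrow> i \<in> V" "v \<in> V \<Longrightarrow> 1 \<le> v"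
proof -
  obtain n where n: "V = {1..n}" using BFS unfolding BFS_labeled_def by blast
  moreover have "V \<noteq> {}" using connected unfolding connected_graph_def by blast
  ultimately show "1 \<in> V" by auto
  show "v \<in> V \<Longrightarrow> 1 \<le> i \<Longrightarrow> i \<le> v \<Longrightarrow> i \<in> V" "v \<in> V \<Longrightarrow> 1 \<le> v" using n by auto
qed

lemma dist_mono: "u \<in> V \<Longrightarrow> v \<in> V \<Longrightarrow> u \<le> v \<Longrightarrow> d 1 u \<le> d 1 v"
  using BFS unfolding BFS_labeled_def by (cases "u = v") auto

lemma less_if_dist_less: "u \<in> V \<Longrightarrow> v \<in> V \<Longrightarrow> d 1 u < d 1 v \<Longrightarrow> u < v"
  using dist_mono[of v u] by linarith

text \<open>Labels increase strictly along a shortest path from 1. Hence a finite set of labels lies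
  in a ball around 1 whose radius is the same in all graphs.\<close>

lemma dist_less_label: "v \<in> V \<Longrightarrow> d 1 v < v"
proof (induction "d 1 v" arbitrary: v)
  case 0 then show ?case using verts_interval(3)[of v] by simp
next
  case (Suc n)
  obtain u where u: "u \<in> V" "d 1 u = n"
    using dist_pred[OF verts_interval(1) Suc.prems] Suc.hyps(2) by metis
  then have "n < u" using Suc.hyps(1)[of u] by simp
  moreover have "u < v" using less_if_dist_less[OF u(1) Suc.prems] u Suc.hyps(2) by simp
  ultimately show ?case using Suc.hyps(2) by simp
qed

end

lemma (in finite_connected_graph) card_neighbours_le:
  assumes "v \<in> V"
  shows "card {u. (v, u) \<in> E} \<le> max_degree G"
proof -
  have fin: "finite (edges G)"
    using simple finite_verts unfolding simple_graph_def
    by (meson Pow_iff finite_Pow_iff finite_subset subsetI)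
  have "inj_on (\<lambda>u. {v, u}) {u. (v, u) \<in> E}" by (auto simp: inj_on_def doubleton_eq_iff)
  then have "card {u. (v, u) \<in> E} \<le> degree G v"
    unfolding degree_def using fin by (intro card_inj_on_le) (auto simp: adj_def)
  also have "\<dots> \<le> max_degree G"
    unfolding max_degree_def using assms finite_verts by (intro Max_ge) auto
  finally show ?thesis .
qed

lemma (in finite_connected_graph) card_ball_le:
  assumes "max_degree G \<le> D" "c \<in> V"
  shows "card {v \<in> V. d c v \<le> R} \<le> (D + 1) ^ R"
proof (induction R)
  case 0
  have "{v \<in> V. d c v \<le> 0} \<subseteq> {c}" using dist_eq_0[OF assms(2)] by auto
  then show ?case using card_mono[of "{c}"] by fastforce
next
  case (Suc R)
  let ?B = "{v \<in> V. d c v \<le> R}"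
  have fin: "finite ?B" "finite {u. (v, u) \<in> E}" for v
    using finite_verts finite_subset[of "{u. (v, u) \<in> E}" V] adjD[OF simple] by auto
  have "{v \<in> V. d c v \<le> Suc R} \<subseteq> (\<Union>u\<in>?B. insert u {v. (u, v) \<in> E})"
  proof
    fix v assume v: "v \<in> {v \<in> V. d c v \<le> Suc R}"
    show "v \<in> (\<Union>u\<in>?B. insert u {v. (u, v) \<in> E})"
    proof (cases "d c v = Suc R")
      case True
      then obtain u where "u \<in> V" "(u, v) \<in> E" "d c u = R" using dist_pred assms(2) v by blast
      then show ?thesis by blast
    next
      case False
      then show ?thesis using v by auto
    qed
  qed
  then have "card {v \<in> V. d c v \<le> Suc R} \<le> card (\<Union>u\<in>?B. insert u {v. (u, v) \<in> E})"
    using fin by (intro card_mono) auto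
  also have "\<dots> \<le> (\<Sum>u\<in>?B. card (insert u {v. (u, v) \<in> E}))"
    using fin by (intro card_UN_le)
  also have "\<dots> \<le> (\<Sum>u\<in>?B. D + 1)"
  proof (intro sum_mono)
    fix u assume "u \<in> ?B"
    then have "card {v. (u, v) \<in> E} \<le> D" using card_neighbours_le[of u] assms(1) by simp
    then show "card (insert u {v. (u, v) \<in> E}) \<le> D + 1"
      using card_insert_le_m1[of "D + 1"] fin(2)[of u] by (simp add: card_insert_if)
  qed
  also have "\<dots> \<le> (D + 1) ^ Suc R" using mult_le_mono1[OF Suc.IH, of "D + 1"] by (simp add: algebra_simps)
  finally show ?case .
qed

text \<open>All labels up to \<open>v\<close> belong to the ball of radius \<open>R\<close>, whose
  size is bounded. So balls of fixed radius use only labels below a constant, where convergence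
  gives control.\<close>

lemma (in BFS_graph) label_le_of_dist:
  assumes "max_degree G \<le> D" "v \<in> V" "d 1 v \<le> R"
  shows "v \<le> (D + 1) ^ R"
proof -
  have "{1..v} \<subseteq> {u \<in> V. d 1 u \<le> R}"
  proof
    fix u assume "u \<in> {1..v}"
    then have "u \<in> V" "u \<le> v" using verts_interval(2)[OF assms(2)] by auto
    then show "u \<in> {u \<in> V. d 1 u \<le> R}" using dist_mono[OF _ assms(2), of u] assms(3) by simp
  qed
  then have "card {1..v} \<le> card {u \<in> V. d 1 u \<le> R}"
    using finite_verts by (intro card_mono) auto
  then show ?thesis using card_ball_le[OF assms(1) verts_interval(1), of R] by simp
qed

section \<open>Passing to the limit\<close>

lemma pointwise_limit_eventually:
  assumes "pointwise_convergent X"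
  shows "eventually (\<lambda>n. x \<in> X n \<longleftrightarrow> x \<in> pointwise_limit X) sequentially"
proof (cases "x \<in> pointwise_limit X")
  case True
  then show ?thesis unfolding pointwise_limit_def by simp
next
  case False
  then have "eventually (\<lambda>n. x \<notin> X n) sequentially"
    using assms unfolding pointwise_convergent_def pointwise_limit_def by blast
  then show ?thesis using False by simp
qed

lemma graphs_converge_eventually_agree:
  fixes G :: "nat \<Rightarrow> nat graph"
  assumes "graphs_converge G L"
  shows "eventually (\<lambda>j. \<forall>u\<in>{..m}. (u \<in> verts (G j) \<longleftrightarrow> u \<in> verts L) \<and>
    (\<forall>v\<in>{..m}. {u, v} \<in> edges (G j) \<longleftrightarrow> {u, v} \<in> edges L)) sequentially"
proof -
  have "eventually (\<lambda>j. u \<in> verts (G j) \<longleftrightarrow> u \<in> verts L) sequentially" for u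
    using assms pointwise_limit_eventually[of "\<lambda>j. verts (G j)"] unfolding graphs_converge_def by simp
  moreover have "eventually (\<lambda>j. e \<in> edges (G j) \<longleftrightarrow> e \<in> edges L) sequentially" for e
    using assms pointwise_limit_eventually[of "\<lambda>j. edges (G j)"] unfolding graphs_converge_def by simp
  ultimately show ?thesis
    by (intro eventually_ball_finite ballI eventually_conj) simp_all
qed

text \<open>Only one far vertex of each ray is carried over to \<open>G j\<close>; its connection to
  the sphere of radius \<open>R\<close> is built inside \<open>G j\<close>. Separation is pulled
  back: a path in \<open>G j\<close> joining two branches would be a path in \<open>L\<close>
  avoiding \<open>S\<close>.\<close>

lemma eventually_branching_of_rays:
  fixes G :: "nat \<Rightarrow> nat graph" and L :: "nat graph"
  assumes bfs: "\<And>j. BFS_graph (G j)"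
    and D: "\<And>j. max_degree (G j) \<le> D"
    and conv: "graphs_converge G L"
    and T: "finite T" "T \<subseteq> rays L" "\<forall>r\<in>T. \<forall>s\<in>T. r \<noteq> s \<longrightarrow> (r, s) \<notin> ray_equiv L"
  shows "\<exists>k. \<forall>R>k. eventually (\<lambda>j. branching (G j) 1 (card T) k R) sequentially"
proof -
  obtain S p where S: "finite S" "S \<subseteq> verts L"
    and sep: "\<forall>r\<in>T. \<forall>s\<in>T. r \<noteq> s \<longrightarrow>
      (\<forall>q\<ge>p. \<forall>q'\<ge>p. (r q, s q') \<notin> (Restr (adj L) (verts L - S))\<^sup>*)"
    using finite_ray_separator[OF T] by (elim exE conjE)
  obtain k where k: "\<forall>v\<in>S. v \<le> k" using S(1) unfolding finite_nat_set_iff_bounded_le ..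
  have "eventually (\<lambda>j. branching (G j) 1 (card T) k R) sequentially" if R: "k < R" for R
  proof -
    \<comment> \<open>Labels in the \<open>R\<close>-ball are at most \<open>m\<close>, so a ray
      vertex with a larger label lies beyond distance \<open>R\<close> in every \<open>G j\<close>
      that contains it.\<close>
    define m where "m = (D + 1) ^ R"
    have "\<exists>q\<ge>p. m < r q" if "r \<in> T" for r
    proof (rule ccontr)
      assume *: "\<not> ?thesis"
      have "inj r" using T(2) that unfolding rays_def by blast
      then have "finite (r -` {..m})" by (intro finite_vimageI) auto
      moreover have "{p..} \<subseteq> r -` {..m}" using * by (auto simp: not_less)
      ultimately show False using infinite_Ici finite_subset by blast
    qed
    then obtain q where q: "\<And>r. r \<in> T \<Longrightarrow> p \<le> q r" "\<And>r. r \<in> T \<Longrightarrow> m < r (q r)" by metis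
    define x where "x r = r (q r)" for r
    have xL: "x r \<in> verts L" if "r \<in> T" for r
      using T(2) that unfolding x_def rays_def by auto
    have "finite (insert m (x ` T))" using T(1) by simp
    then obtain M where M: "\<forall>v\<in>insert m (x ` T). v \<le> M"
      unfolding finite_nat_set_iff_bounded_le ..
    show ?thesis
    proof (rule eventually_mono[OF graphs_converge_eventually_agree[OF conv, of M]])
      fix j
      assume agree: "\<forall>u\<in>{..M}. (u \<in> verts (G j) \<longleftrightarrow> u \<in> verts L) \<and>
        (\<forall>v\<in>{..M}. {u, v} \<in> edges (G j) \<longleftrightarrow> {u, v} \<in> edges L)"
      interpret BFS_graph "G j" by (rule bfs)
      \<comment> \<open>On labels up to \<open>M\<close> the graphs \<open>G j\<close> and
        \<open>L\<close> agree, and vertices farther than \<open>k\<close> from 1 have labels above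
        \<open>k\<close>, hence avoid \<open>S\<close>. Paths in \<open>H\<close> are thus paths of
        \<open>L\<close> outside \<open>S\<close>.\<close>
      define H where "H = {v \<in> V. v \<le> M \<and> k < d 1 v}"
      have H_L: "H \<subseteq> verts L - S"
      proof
        fix v assume v: "v \<in> H"
        then have "k < v" using dist_less_label[of v] unfolding H_def by simp
        then have "v \<notin> S" using k by fastforce
        then show "v \<in> verts L - S" using v agree unfolding H_def by auto
      qed
      have "Restr E H \<subseteq> Restr (adj L) (verts L - S)"
        using H_L agree unfolding H_def adj_def by auto
      then have path_L: "(u, v) \<in> (Restr (adj L) (verts L - S))\<^sup>*" if "(u, v) \<in> (Restr E H)\<^sup>*" for u v
        using rtrancl_mono that by blast
      have "\<exists>a\<in>V. d 1 a = R \<and> (a, x r) \<in> (Restr E H)\<^sup>*" if r: "r \<in> T" for r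
      proof -
        have xM: "x r \<le> M" "m < x r" using M q r unfolding x_def by auto
        then have xV: "x r \<in> V" using agree xL[OF r] by auto
        have far: "R < d 1 (x r)"
        proof (rule ccontr)
          assume "\<not> R < d 1 (x r)"
          then have "x r \<le> m" using label_le_of_dist[OF D xV] unfolding m_def by simp
          then show False using xM by simp
        qed
        then obtain n where n: "d 1 (x r) = Suc n" "R \<le> n" by (cases "d 1 (x r)") auto
        \<comment> \<open>Up to the predecessor \<open>u\<close> all distances are strictly below
          that of \<open>x r\<close>, so the BFS order keeps the labels below
          \<open>x r \<le> M\<close> and the path in \<open>H\<close>.\<close>
        obtain u where u: "u \<in> V" "(u, x r) \<in> E" "d 1 u = n"
          using dist_pred[OF verts_interval(1) xV n(1)] by metis
        obtain a where a: "a \<in> V" "d 1 a = R" "(a, u) \<in> (Restr E {v \<in> V. R \<le> d 1 v \<and> d 1 v \<le> n})\<^sup>*"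
          using geodesic[OF verts_interval(1) u(1), of R] u(3) n(2) by auto
        have sub: "{v \<in> V. R \<le> d 1 v \<and> d 1 v \<le> n} \<subseteq> H"
        proof
          fix v assume v: "v \<in> {v \<in> V. R \<le> d 1 v \<and> d 1 v \<le> n}"
          then have "v < x r" using less_if_dist_less[of v "x r"] xV n by auto
          then show "v \<in> H" using v xM R unfolding H_def by auto
        qed
        have "u \<in> H" using sub u n by auto
        moreover have "x r \<in> H" using xV xM far R unfolding H_def by auto
        ultimately have "(u, x r) \<in> (Restr E H)\<^sup>*" using u(2) by blast
        then have "(a, x r) \<in> (Restr E H)\<^sup>*"
          using Restr_rtrancl_mono[OF a(3) sub] by (rule rtrancl_trans[rotated])
        then show ?thesis using a by blast
      qed
      then obtain a where a: "\<And>r. r \<in> T \<Longrightarrow> a r \<in> V" "\<And>r. r \<in> T \<Longrightarrow> d 1 (a r) = R"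
        "\<And>r. r \<in> T \<Longrightarrow> (a r, x r) \<in> (Restr E H)\<^sup>*" by metis
      have a_sep: "(a r, a s) \<notin> (Restr E H)\<^sup>*" if rs: "r \<in> T" "s \<in> T" "r \<noteq> s" for r s
      proof
        assume *: "(a r, a s) \<in> (Restr E H)\<^sup>*"
        have "(x r, a r) \<in> (Restr E H)\<^sup>*" using a(3)[OF rs(1)] path_commute by metis
        then have "(x r, x s) \<in> (Restr E H)\<^sup>*" using * a(3)[OF rs(2)] by (meson rtrancl_trans)
        then have "(x r, x s) \<in> (Restr (adj L) (verts L - S))\<^sup>*" by (rule path_L)
        moreover have "(x r, x s) \<notin> (Restr (adj L) (verts L - S))\<^sup>*"
          using sep rs q(1)[OF rs(1)] q(1)[OF rs(2)] unfolding x_def by blast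
        ultimately show False by blast
      qed
      have shell_H: "shell (G j) 1 k R \<subseteq> H"
      proof
        fix v assume v: "v \<in> shell (G j) 1 k R"
        then have "v \<le> m" using label_le_of_dist[OF D, of v R] unfolding shell_def m_def by simp
        then show "v \<in> H" using v M unfolding H_def shell_def by auto
      qed
      have "inj_on a T" using a_sep by (intro inj_onI) (metis rtrancl.rtrancl_refl)
      show "branching (G j) 1 (card T) k R"
        unfolding branching_def
      proof (intro exI[of _ "a ` T"] conjI ballI impI)
        show "card (a ` T) = card T" using \<open>inj_on a T\<close> by (rule card_image)
        fix y z assume "y \<in> a ` T" "z \<in> a ` T" "y \<noteq> z"
        then obtain r s where "y = a r" "z = a s" "r \<in> T" "s \<in> T" "r \<noteq> s" by blast
        then show "(y, z) \<notin> (Restr E (shell (G j) 1 k R))\<^sup>*"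
          using a_sep Restr_rtrancl_mono[OF _ shell_H] by metis
      qed (use T(1) a in auto)
    qed
  qed
  then show ?thesis by blast
qed

text \<open>Each step of \<open>branching_Suc\<close> needs larger balls, which is why branching is only
  asked for eventually in \<open>j\<close>.\<close>

lemma eventually_branching_all:
  fixes G :: "nat \<Rightarrow> nat graph"
  assumes bfs: "\<And>j. BFS_graph (G j)"
    and trans: "\<And>j. edge_transitive (G j)"
    and three: "\<forall>R>r. eventually (\<lambda>j. branching (G j) 1 3 r R) sequentially"
  shows "\<exists>k. \<forall>R>k. eventually (\<lambda>j. branching (G j) 1 (N + 3) k R) sequentially"
proof (induction N)
  case 0
  then show ?case using three by auto
next
  case (Suc N)
  then obtain k where k: "\<And>R. k < R \<Longrightarrow> eventually (\<lambda>j. branching (G j) 1 (N + 3) k R) sequentially"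
    by blast
  have "eventually (\<lambda>j. branching (G j) 1 (Suc N + 3) (k + 2 * r + 4) R) sequentially"
    if R: "k + 2 * r + 4 < R" for R
  proof -
    have "eventually (\<lambda>j. branching (G j) 1 (N + 3) k R) sequentially" using k R by simp
    moreover have "eventually (\<lambda>j. branching (G j) 1 3 r (R + k + r + 4)) sequentially"
      using three by simp
    ultimately show ?thesis
    proof eventually_elim
      case (elim j)
      interpret BFS_graph "G j" by (rule bfs)
      \<comment> \<open>\<open>Q\<close> is the orbit of 1: it inherits the three branches at 1 and
        comes within distance 1 of every vertex.\<close>
      have "branching (G j) 1 (Suc (N + 3)) (k + 2 * r + 4) R"
        using R elim automorphism_in[OF _ verts_interval(1)]
          branching_automorphism[OF _ verts_interval(1)]
        by (intro branching_Suc[OF elim(1) _ verts_interval(1)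
          edge_transitive_orbit_near[OF trans verts_interval(1)]]) auto
      then show ?case by simp
    qed
  qed
  then show ?case by blast
qed

theorem theorem4p14:
  fixes G :: "nat \<Rightarrow> nat graph" and L :: "nat graph"
  assumes "\<And>i. simple_graph (G i)"
    and "\<And>i. finite (verts (G i))"
    and "\<And>i. connected_graph (G i)"
    and "\<And>i. BFS_labeled (G i)"
    and "\<And>i. edge_transitive (G i)"
    and "\<exists>D. \<forall>i. max_degree (G i) \<le> D"
    and "graphs_converge G L"
    and "infinite (ends L) \<or> card (ends L) > 2"
  shows "filterlim (\<lambda>j. Had (G j)) at_top sequentially"
proof -
  have bfs: "BFS_graph (G j)" for j
    using assms(1-4) by unfold_locales
  obtain D where D: "\<And>i. max_degree (G i) \<le> D" using assms(6) by blast
  obtain T where T: "finite T" "card T = 3" "T \<subseteq> rays L"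
    "\<forall>r\<in>T. \<forall>s\<in>T. r \<noteq> s \<longrightarrow> (r, s) \<notin> ray_equiv L"
    by (rule inequivalent_rays[of L 3]) (use assms(8) in auto)
  obtain r where r: "\<forall>R>r. eventually (\<lambda>j. branching (G j) 1 3 r R) sequentially"
    using eventually_branching_of_rays[OF bfs D assms(7) T(1,3,4)] T(2) by auto
  show ?thesis
    unfolding filterlim_at_top
  proof
    fix h
    \<comment> \<open>\<open>2 ^ Suc h\<close> is the density that forces \<open>h\<close> touching
      sets, and 3 is where the induction on the number of branches starts. Now that \<open>k\<close>
      is fixed, \<open>R\<close> can be set to the radius \<open>6 * k + 4\<close> required by the
      cells.\<close>
    obtain k where "\<forall>R>k. eventually (\<lambda>j. branching (G j) 1 (2 ^ Suc h + 3) k R) sequentially"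
      using eventually_branching_all[OF bfs assms(5) r] by blast
    then have "eventually (\<lambda>j. branching (G j) 1 (2 ^ Suc h + 3) k (6 * k + 4)) sequentially"
      by simp
    then show "eventually (\<lambda>j. h \<le> Had (G j)) sequentially"
    proof eventually_elim
      case (elim j)
      interpret BFS_graph "G j" by (rule bfs)
      show ?case
      proof (rule Had_ge_of_branching[where Q = "{f 1 |f. automorphism (G j) f}"])
        show "{f 1 |f. automorphism (G j) f} \<subseteq> V"
          using automorphism_in[OF _ verts_interval(1)] by blast
        show "branching (G j) w (2 ^ Suc h + 3) k (6 * k + 4)"
          if "w \<in> {f 1 |f. automorphism (G j) f}" for w
          using that branching_automorphism[OF _ verts_interval(1) elim] by blast
        show "\<exists>w\<in>{f 1 |f. automorphism (G j) f}. w = v \<or> (v, w) \<in> E" if "v \<in> V" for v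
          using edge_transitive_orbit_near[OF assms(5) verts_interval(1) that] .
      qed simp
    qed
  qed
qed

end
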